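(* Let $p$ be a prime of the form $12k+1$, and let $x,y$ be integers with $p=x^2+9y^2$ (such integers exist). Then $$\sum_{k=0}^{p-1}\binom{2k}{k}\frac{f_k}{(-16)^k}\equiv 4x^2\pmod p.$$
   Context: The Franel numbers are $f_n=\sum_{k=0}^n\binom{n}{k}^3$ for $n=0,1,2,\ldots$. Congruences modulo $p$ are taken in the ring of rational numbers whose denominator is not divisible by $p$. *)

theory Defs
  imports Complex_Main "HOL-Computational_Algebra.Primes"
begin

definition franel :: "nat \<Rightarrow> nat" where
  "franel n = (\<Sum>k\<le>n. (n choose k) ^ 3)"

text \<open>The subring of the rationals whose reduced denominator is not divisible by \<open>p\<close>;
  \<^const>\<open>quotient_of\<close> returns the fraction in lowest terms.\<close>

definition p_integral :: "nat \<Rightarrow> rat set" where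
  "p_integral p = {q. \<not> int p dvd snd (quotient_of q)}"

text \<open>Congruence modulo \<open>p\<close> in the ring \<open>p_integral p\<close>: both sides lie in the ring and their
  difference lies in the principal ideal generated by \<open>p\<close>.\<close>

definition rat_cong :: "rat \<Rightarrow> rat \<Rightarrow> nat \<Rightarrow> bool" where
  "rat_cong a b p \<longleftrightarrow> a \<in> p_integral p \<and> b \<in> p_integral p \<and>
     (\<exists>c \<in> p_integral p. a - b = of_nat p * c)"

end

theory Submission
  imports Defs "HOL-Number_Theory.Number_Theory" "HOL-Computational_Algebra.Polynomial"
begin

text \<open>
  Let \<open>f\<close> be the sequence of Franel numbers, \<open>n = (p - 1) / 2\<close>, and let \<open>S\<close> be the sum
  in question. Modulo \<open>p\<close> the sum is the square of the trace of Frobenius of an elliptic curve with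
  complex multiplication by \<open>i\<close>, and a point of order three on that curve decides which
  of the two squares in \<open>p = A\<^sup>2 + B\<^sup>2\<close> occurs. The argument has three parts.

  \<^item> \<^emph>\<open>A Clausen formula modulo p\<close> (\<open>clausen_franel\<close>). Put \<open>G(z) = \<Sum>k<p. f k * z^k\<close>. Then
  \<open>G(z)\<^sup>2\<close> and the sum over \<open>k \<le> n\<close> of
  \<open>(2k choose k) * f k * (z (1 + z) (1 - 8z))^k * (1 + 8z\<^sup>2)^(p - 1 - 2k)\<close>
  agree as polynomials modulo \<open>p\<close>. Both are annihilated by the symmetric square of
  the second-order differential equation of the Franel numbers, and a solution of degree
  at most \<open>2p - 2\<close> is determined modulo \<open>p\<close> by its coefficients of degree \<open>0\<close> and \<open>2p - 2\<close>. At a root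
  of \<open>8z\<^sup>2 + 4z - 1\<close>, which exists modulo \<open>p\<close> because \<open>3\<close> is a square, the quotient
  \<open>z (1 + z) (1 - 8z) / (1 + 8z\<^sup>2)\<^sup>2\<close> is \<open>-1/16\<close>; hence \<open>S\<close> is congruent to \<open>G(z)\<^sup>2\<close>
  (\<open>franel_sum_square\<close>).

  \<^item> \<^emph>\<open>A point count\<close> (\<open>torus_count_cong\<close>, \<open>torus_count_eq_sum\<close>). The Franel number \<open>f k\<close> is the constant term of
  \<open>((1 + x) (1 + y) (1 + 1/(xy)))^k\<close>, so \<open>G(z)\<close> is determined modulo \<open>p\<close> by
  the number \<open>N\<close> of nonzero solutions of \<open>(1 + x) (1 + y) (1 + xy) = w xy\<close> with \<open>w = 1/z\<close>: one finds
  \<open>N \<equiv> -5 - G(z)\<close>. Fibering the curve over a line expresses \<open>N\<close> by a quadratic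
  character sum over a cubic, and for this \<open>w\<close>, a root of \<open>w\<^sup>2 = 4w + 8\<close>, the cubic
  can be brought to the form \<open>x (x\<^sup>2 + b)\<close>. Thus \<open>N = p - 5 + J b\<close> with the Jacobsthal sum \<open>J b\<close>, and \<open>G(z) \<equiv> - J b\<close>.

  \<^item> \<^emph>\<open>Jacobsthal's theorem and the prime 3\<close> (\<open>cubic_sum_two_squares\<close>, \<open>three_dvd_torus_count\<close>). One has
  \<open>J b = 2A\<close> with \<open>p = A\<^sup>2 + B\<^sup>2\<close>. Rotating \<open>(x, y, 1/(xy))\<close> permutes the \<open>N\<close> points
  without fixed points, so \<open>3\<close> divides \<open>N = p - 5 + 2A\<close>, and therefore \<open>3\<close> does not
  divide \<open>A\<close>. Since \<open>p \<equiv> 1\<close> modulo \<open>3\<close>, it divides \<open>B\<close> instead. This gives \<open>p = A\<^sup>2 + 9 (B/3)\<^sup>2\<close> and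
  \<open>S \<equiv> 4A\<^sup>2\<close>; uniqueness of the representation as a sum of two squares does the rest.
\<close>

section \<open>The Franel recurrence\<close>

text \<open>
  Zeilberger's method: with \<open>t k = (n! / (k! (n + 2 - k)!))\<^sup>3\<close> the three cubed binomial
  coefficients are polynomial multiples of \<open>t k\<close>, and the summand telescopes
  with certificate \<open>k\<^sup>3 * s k * t k\<close>. The polynomial \<open>s\<close> solves a linear system.
\<close>
lemma franel_recurrence_aux:
  fixes n :: nat
  shows "(real n + 2)^2 * real (franel (n+2)) =
         (7 * real n^2 + 21 * real n + 16) * real (franel (n+1)) + 8 * (real n + 1)^2 * real (franel n)"
proof -
  define t :: "nat \<Rightarrow> real" where "t k = (fact n / (fact k * fact (n+2-k))) ^ 3" for k
  define s :: "real \<Rightarrow> real" where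
    "s k = (real n+1)^2 * (4*k^3 - 30*k^2 + 78*k - 72 + real n * (-18*k^2 + 93*k - 128)
              + real n^2 * (27*k - 74) - 14 * real n^3)" for k
  define g :: "nat \<Rightarrow> real" where "g k = (if k \<le> n
      + 2 then real k^3 * s (real k) * t k else 0)" for k
  have cancel_aux: "a / (b * c) = a / (b * (x * y * c)) * (y * x)"
      if "x \<noteq> 0" "y \<noteq> 0" for a b c x y :: real
    using that by simp
  have cancel_aux2: "(x * a) / (b * c) = a / (b * (y * c)) * (x * y)" if "y \<noteq> 0" for a b c x y :: real
    using that by simp
  have cancel_aux3: "(x * y * a) / b = a / b * (y * x)" for a b x y :: real
    by simp
  have b0: "real (n choose k) ^ 3 = t k * ((real n + 1 - real k) * (real n + 2 - real k)) ^ 3"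
      if "k \<le> n + 2" for k
  proof (cases "k \<le> n")
    case True
    then obtain d where d: "n = k + d" using le_Suc_ex by blast
    have "real (n choose k) = fact n / (fact k * fact d)" using True by (simp add: binomial_fact d)
    moreover have "fact (n+2-k) = (real d + 2) * (real d + 1) * fact d"
      by (simp add: d numeral_2_eq_2 algebra_simps)
    moreover have "real n + 1 - real k = real d + 1" "real n + 2 - real k = real d + 2" by (simp_all add: d)
    moreover have "real d + 2 \<noteq> 0" "real d + 1 \<noteq> 0" by linarith+
    ultimately show ?thesis unfolding t_def power_mult_distrib[symmetric]
      by (metis cancel_aux)
  next
    case False
    hence "k = n + 1 \<or> k = n + 2" using that by auto
    thus ?thesis using False by (auto simp: binomial_eq_0)
  qed
  have b1: "real ((n+1) choose k) ^ 3 = t k * ((real n + 1) * (real n + 2 - real k)) ^ 3"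
      if "k \<le> n + 2" for k
  proof (cases "k \<le> n + 1")
    case True
    then obtain d where d: "n + 1 = k + d" using le_Suc_ex by blast
    have "real ((n+1) choose k) = fact (n+1) / (fact k * fact d)"
      using True unfolding d by (simp add: binomial_fact)
    moreover have "fact (n+2-k) = (real d + 1) * fact d"
    proof -
      have "n + 2 - k = Suc d" using d by simp
      thus ?thesis by simp
    qed
    moreover have "real n + 2 - real k = real d + 1" using d by linarith
    moreover have "fact (n+1) = (real n + 1) * fact n" by simp
    moreover have "real d + 1 \<noteq> 0" by linarith
    ultimately show ?thesis unfolding t_def power_mult_distrib[symmetric]
      by (metis cancel_aux2)
  next
    case False
    hence "k = n + 2" using that by auto
    thus ?thesis by (auto simp: binomial_eq_0)
  qed
  have b2: "real ((n+2) choose k) ^ 3 = t k * ((real n + 1) * (real n + 2)) ^ 3" if "k \<le> n + 2" for k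
  proof -
    have "real ((n+2) choose k) = fact (n+2) / (fact k * fact (n+2-k))"
      using that by (simp add: binomial_fact)
    moreover have "fact (n+2) = (real n + 2) * (real n + 1) * fact n"
      by (simp add: numeral_2_eq_2 algebra_simps)
    ultimately show ?thesis unfolding t_def power_mult_distrib[symmetric]
      by (metis cancel_aux3)
  qed
  have gS: "g (Suc k) = t k * ((real n + 2 - real k)^3 * s (real k + 1))" if "k \<le> n + 2" for k
  proof (cases "k = n + 2")
    case True thus ?thesis by (simp add: g_def)
  next
    case False
    hence "k < n + 2" using that by simp
    then obtain d where d: "n + 2 = k + Suc d" using less_imp_Suc_add by auto
    have "real (Suc k) ^ 3 * t (Suc k) = t k * (real n + 2 - real k)^3"
    proof -
      have e: "n + 2 - k = Suc d" "n + 2 - Suc k = d" "real n + 2 - real k = real d + 1" using d by linarith+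
      show ?thesis unfolding t_def power_mult_distrib[symmetric] e
        by (intro arg_cong[where f="\<lambda>x. x^3"]) (simp add: divide_simps)
    qed
    thus ?thesis using d by (simp add: g_def algebra_simps)
  qed
  have key: "(real n + 2)^2 * real ((n+2) choose k)^3 - (7 * real n^2 + 21 * real n
      + 16) * real ((n+1) choose k)^3
      - 8 * (real n + 1)^2 * real (n choose k)^3 = g (Suc k) - g k" if "k \<le> n + 2" for k
  proof -
    have gk: "g k = t k * (real k^3 * s (real k))" using that by (simp add: g_def)
    have "(real n + 2)^2 * ((real n + 1) * (real n + 2)) ^ 3
        - (7 * real n^2 + 21 * real n + 16) * ((real n + 1) * (real n + 2 - real k)) ^ 3
        - 8 * (real n + 1)^2 * ((real n + 1 - real k) * (real n + 2 - real k)) ^ 3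
        = (real n + 2 - real k)^3 * s (real k + 1) - real k^3 * s (real k)"
      unfolding s_def by (simp add: eval_nat_numeral algebra_simps)
    hence "t k * ((real n + 2)^2 * ((real n + 1) * (real n + 2)) ^ 3
        - (7 * real n^2 + 21 * real n + 16) * ((real n + 1) * (real n + 2 - real k)) ^ 3
        - 8 * (real n + 1)^2 * ((real n + 1 - real k) * (real n + 2 - real k)) ^ 3)
        = g (Suc k) - g k" unfolding gS[OF that] gk by (simp add: right_diff_distrib)
    thus ?thesis unfolding b0[OF that] b1[OF that] b2[OF that] by (simp add: algebra_simps)
  qed
  have f0: "real (franel n) = (\<Sum>k\<le>n+2. real (n choose k)^3)"
    unfolding franel_def of_nat_sum of_nat_power by (intro sum.mono_neutral_left) (auto simp: binomial_eq_0)
  have f1: "real (franel (n+1)) = (\<Sum>k\<le>n+2. real ((n+1) choose k)^3)"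
    unfolding franel_def of_nat_sum of_nat_power by (intro sum.mono_neutral_left) (auto simp: binomial_eq_0)
  have f2: "real (franel (n+2)) = (\<Sum>k\<le>n+2. real ((n+2) choose k)^3)"
    unfolding franel_def of_nat_sum of_nat_power ..
  have "(real n + 2)^2 * real (franel (n+2)) - (7 * real n^2 + 21 * real n + 16) * real (franel (n+1))
      - 8 * (real n + 1)^2 * real (franel n) = (\<Sum>k\<le>n+2. g (Suc k) - g k)"
    unfolding f0 f1 f2 sum_distrib_left sum_subtractf[symmetric] using key by (intro sum.cong) auto
  also have "\<dots> = g (Suc (n+2)) - g 0" by (rule sum_telescope[of "\<lambda>k. - g k", simplified]) 
  also have "\<dots> = 0" by (simp add: g_def)
  finally show ?thesis by simp
qed

section \<open>Polynomials modulo a prime\<close>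

definition pcong :: "nat \<Rightarrow> int poly \<Rightarrow> int poly \<Rightarrow> bool" where
  "pcong p A B \<longleftrightarrow> [:int p:] dvd A - B"

lemma pcong_iff_coeff: "pcong p A B \<longleftrightarrow> (\<forall>i. [coeff A i = coeff B i] (mod int p))"
  by (simp add: pcong_def const_poly_dvd_iff cong_iff_dvd_diff)

lemma pcong_refl [simp]: "pcong p A A" by (simp add: pcong_def)
lemma pcong_trans [trans]: "pcong p A B \<Longrightarrow> pcong p B C \<Longrightarrow> pcong p A C"
  unfolding pcong_iff_coeff using cong_trans by blast

text \<open>Mixed transitivity rules keep calculations from trying higher-order substitution into polynomials.\<close>
lemma pcong_eq_trans [trans]: "pcong p A B \<Longrightarrow> B = C \<Longrightarrow> pcong p A C" by simp
lemma eq_pcong_trans [trans]: "A = B \<Longrightarrow> pcong p B C \<Longrightarrow> pcong p A C" by simp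
lemma pcong_add: "pcong p A B \<Longrightarrow> pcong p C D \<Longrightarrow> pcong p (A + C) (B + D)"
  by (auto simp: pcong_iff_coeff cong_add)
lemma pcong_diff: "pcong p A B \<Longrightarrow> pcong p C D \<Longrightarrow> pcong p (A - C) (B - D)"
  by (auto simp: pcong_iff_coeff cong_diff)
lemma pcong_mult:
  assumes "pcong p A B" "pcong p C D" shows "pcong p (A * C) (B * D)"
proof -
  have "A * C - B * D = (A - B) * C + B * (C - D)" by (simp add: algebra_simps)
  thus ?thesis using assms unfolding pcong_def by (metis dvd_add dvd_mult dvd_mult2)
qed

lemma pcong_lmult: "pcong p A B \<Longrightarrow> pcong p (C * A) (C * B)"
  by (rule pcong_mult) simp_all
lemma pcong_pderiv: "pcong p A B \<Longrightarrow> pcong p (pderiv A) (pderiv B)"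
  by (auto simp: pcong_iff_coeff coeff_pderiv intro!: cong_scalar_left)
lemma pcong_sum: "(\<And>i. i \<in> I \<Longrightarrow> pcong p (f i) (g i))
    \<Longrightarrow> pcong p (sum f I) (sum g I)"
  by (auto simp: pcong_iff_coeff coeff_sum intro!: cong_sum)
lemma pcong_poly:
  assumes "pcong p A B" shows "[poly A x = poly B x] (mod int p)"
proof -
  from assms obtain C where "A - B = [:int p:] * C" unfolding pcong_def by (elim dvdE)
  hence "poly (A - B) x = poly ([:int p:] * C) x" by simp
  hence "poly A x - poly B x = int p * poly C x" by simp
  thus ?thesis by (simp add: cong_iff_dvd_diff)
qed

text \<open>A prime number stays prime as a constant polynomial.\<close>
lemma pcong_cancel:
  assumes "prime p" "\<not> [:int p:] dvd C" "pcong p (C * A) (C * B)" shows "pcong p A B"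
proof -
  have "prime_elem [:int p:]" using assms(1) by (simp add: prime_elem_const_poly_iff)
  moreover have "[:int p:] dvd C * (A - B)" using assms(3) by (simp add: pcong_def right_diff_distrib)
  ultimately show ?thesis using assms(2) unfolding pcong_def by (metis prime_elem_dvd_multD)
qed

section \<open>The symmetric square of the Franel equation\<close>

text \<open>
  The generating function \<open>y\<close> of the Franel numbers satisfies \<open>(P y')' = (2 + 8z) y\<close> with
  \<open>P = z (1 + z) (1 - 8z)\<close>. In terms of the derivation \<open>\<theta> = P d/dz\<close> this is \<open>\<theta>\<^sup>2 y = V y\<close>
  with \<open>V = (2 + 8z) P\<close>, so that \<open>y\<^sup>2\<close> is annihilated by the operator \<open>L3\<close>.
  The polynomial \<open>Q = 1 + 8z\<^sup>2\<close> enters through the Clausen argument \<open>P / Q\<^sup>2\<close>.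
\<close>
definition ode_P :: "int poly" where "ode_P = [:0, 1, -7, -8:]"
definition ode_Q :: "int poly" where "ode_Q = [:1, 0, 8:]"
definition ode_V :: "int poly" where "ode_V = [:2, 8:] * ode_P"
definition theta :: "int poly \<Rightarrow> int poly" where "theta y = ode_P * pderiv y"
definition L3 :: "int poly \<Rightarrow> int poly" where
  "L3 y = theta (theta (theta y)) - 4 * ode_V * theta y - 2 * theta ode_V * y"

lemma theta_add: "theta (a + b) = theta a + theta b" by (simp add: theta_def pderiv_add algebra_simps)
lemma theta_diff: "theta (a - b) = theta a - theta b" by (simp add: theta_def pderiv_diff algebra_simps)
lemma theta_mult: "theta (a * b) = a * theta b + theta a * b" by (simp add: theta_def pderiv_mult algebra_simps)
lemma theta_0 [simp]: "theta 0 = 0" by (simp add: theta_def)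
lemma theta_1 [simp]: "theta 1 = 0" by (simp add: theta_def)
lemma theta_numeral [simp]: "theta (numeral k) = 0" 
  by (simp add: theta_def pderiv_eq_0_iff)
lemma theta_of_nat [simp]: "theta (of_nat c) = 0" by (simp add: theta_def)
lemma pcong_theta: "pcong p A B \<Longrightarrow> pcong p (theta A) (theta B)"
  unfolding theta_def by (intro pcong_lmult pcong_pderiv)
lemma L3_diff: "L3 (a - b) = L3 a - L3 b"
  by (simp add: L3_def theta_diff algebra_simps)
lemma L3_sum: "L3 (sum f I) = (\<Sum>i\<in>I. L3 (f i))"
  by (induction I rule: infinite_finite_induct) (auto simp: L3_def theta_add algebra_simps)

text \<open>The truncated subtractions are harmless: whenever they truncate, the factor in front vanishes.\<close>
lemma coeff_theta: "coeff (theta y) i = int i * coeff y i - 7 * int (i - 1) * coeff y (i - 1)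
                    - 8 * int (i - 2) * coeff y (i - 2)"
proof -
  have e: "theta y = pCons 0 (pderiv y + pCons 0 (smult (-7) (pderiv y) + pCons 0 (smult (-8) (pderiv y))))"
    by (simp add: theta_def ode_P_def algebra_simps)
  consider "i = 0" | "i = 1" | "i = 2" | m where "i = Suc (Suc (Suc m))"
    by (metis One_nat_def Suc_1 not0_implies_Suc)
  thus ?thesis by cases (simp_all add: e coeff_pderiv numeral_2_eq_2 algebra_simps)
qed

text \<open>
  The next lemmas track the extreme coefficients that are nonzero modulo \<open>p\<close>. At the lower end \<open>\<theta>\<close>
  acts like \<open>z d/dz\<close> and \<open>V\<close> has no constant term; at the upper end \<open>\<theta>\<close>
  acts like \<open>-8 z\<^sup>3 d/dz\<close>. Hence \<open>L3\<close> multiplies the lowest coefficient by the cube \<open>j\<^sup>3\<close>, and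
  the top one by \<open>-512 (j + 2)\<^sup>3\<close>: these cubes are the indicial polynomials at \<open>0\<close> and at \<open>\<infinity>\<close>.
\<close>
lemma lowest_coeff_theta:
  assumes "\<forall>i<j. int p dvd coeff y i"
  shows "\<forall>i<j. int p dvd coeff (theta y) i" and "[coeff (theta y) j = int j * coeff y j] (mod int p)"
proof -
  have a: "int p dvd int (i - 1) * coeff y (i - 1)" "int p dvd int (i - 2) * coeff y (i - 2)"
      if "i \<le> j" for i
    using assms that by (cases "i \<le> 1"; force)+
  show "\<forall>i<j. int p dvd coeff (theta y) i"
    unfolding coeff_theta using assms a by (auto intro!: dvd_diff simp: mult.assoc)
  show "[coeff (theta y) j = int j * coeff y j] (mod int p)"
    unfolding coeff_theta cong_iff_dvd_diff using a[of j]
    by (simp add: mult.assoc dvd_diff)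
qed

lemma lowest_coeff_mult:
  assumes "\<forall>i<j. int p dvd coeff y i" "coeff A 0 = 0" "i \<le> j"
  shows "int p dvd coeff (A * y) i"
  unfolding coeff_mult
proof (intro dvd_sum)
  fix l assume "l \<in> {..i}"
  thus "int p dvd coeff A l * coeff y (i - l)"
    using assms by (cases "l = 0") auto
qed

lemma top_coeff_theta:
  assumes "\<forall>i>j. int p dvd coeff y i"
  shows "\<forall>i>j+2. int p dvd coeff (theta y) i" and "[coeff (theta y) (j + 2)
      = -8 * int j * coeff y j] (mod int p)"
  using assms unfolding coeff_theta cong_iff_dvd_diff by (auto intro!: dvd_diff simp: mult.assoc)

lemma top_coeff_mult:
  assumes "\<forall>i>j. int p dvd coeff y i" "degree A \<le> a"
  shows "\<forall>i>j+a. int p dvd coeff (A * y) i" and "[coeff (A * y) (a + j)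
      = coeff A a * coeff y j] (mod int p)"
proof -
  have *: "int p dvd coeff A l * coeff y (i - l)" if "i \<ge> j + a" "l \<le> i" "\<not> (i
      = j + a \<and> l = a)" for i l
  proof (cases "l > a")
    case True thus ?thesis using assms(2) by (simp add: coeff_eq_0)
  next
    case False
    hence "i - l > j" using that by auto
    thus ?thesis using assms(1) by auto
  qed
  show "\<forall>i>j+a. int p dvd coeff (A * y) i" unfolding coeff_mult
    by (intro allI impI dvd_sum *) auto
  have "coeff (A * y) (a + j) = coeff A a * coeff y j + (\<Sum>l\<in>{..a+j}-{a}. coeff A l
      * coeff y (a + j - l))"
    unfolding coeff_mult by (subst sum.remove[of _ a]) auto
  moreover have "int p dvd (\<Sum>l\<in>{..a+j}-{a}. coeff A l * coeff y (a + j - l))"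
    by (intro dvd_sum *) auto
  ultimately show "[coeff (A * y) (a + j) = coeff A a * coeff y j] (mod int p)"
    by (simp add: cong_iff_dvd_diff)
qed

lemma coeff_ode_V_0: "coeff ode_V 0 = 0" "coeff (theta ode_V) 0 = 0"
  by (simp_all add: ode_V_def ode_P_def coeff_theta)
lemma deg_theta_V: "degree (theta ode_V) \<le> 6" "coeff (theta ode_V) 6 = 2048"
proof -
  show "degree (theta ode_V) \<le> 6" by (simp add: ode_V_def ode_P_def theta_def pderiv_pCons)
  show "coeff (theta ode_V) 6 = 2048" by (simp add: ode_V_def ode_P_def coeff_theta numeral_eq_Suc)
qed

lemma lowest_coeff_L3:
  assumes "\<forall>i<j. int p dvd coeff y i"
  shows "[coeff (L3 y) j = int j ^ 3 * coeff y j] (mod int p)"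
proof -
  note d1 = lowest_coeff_theta[OF assms] 
  note d2 = lowest_coeff_theta[OF d1(1)]
  note d3 = lowest_coeff_theta[OF d2(1)]
  have "[coeff (theta (theta (theta y))) j = int j * (int j * (int j * coeff y j))] (mod int p)"
    using d1(2) d2(2) d3(2) by (meson cong_scalar_left cong_trans)
  moreover have "[coeff (4 * ode_V * theta y) j = 0] (mod int p)"
    unfolding cong_0_iff by (rule lowest_coeff_mult[OF d1(1)]) (simp_all add: coeff_ode_V_0 coeff_mult_0)
  moreover have "[coeff (2 * theta ode_V * y) j = 0] (mod int p)"
    unfolding cong_0_iff by (rule lowest_coeff_mult[OF assms]) (simp_all add: coeff_ode_V_0 coeff_mult_0)
  ultimately have "[coeff (L3 y) j = int j * (int j * (int j * coeff y j)) - 0 - 0] (mod int p)"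
    unfolding L3_def coeff_diff by (intro cong_diff)
  thus ?thesis by (simp add: power3_eq_cube mult.assoc)
qed

lemma top_coeff_L3:
  assumes "\<forall>i>j. int p dvd coeff y i"
  shows "[coeff (L3 y) (j + 6) = -512 * (int j + 2) ^ 3 * coeff y j] (mod int p)"
proof -
  note d1 = top_coeff_theta[OF assms] 
  note d2 = top_coeff_theta[OF d1(1)]
  note d3 = top_coeff_theta[OF d2(1)]
  have s: "j + 6 = j + 2 + 2 + 2" "j + 6 = 4 + (j + 2)" "j + 6 = 6 + j" by auto
  have "[coeff (theta (theta (theta y))) (j + 6) = (-8 * int (j + 2 + 2)) * ((-8 * int (j
      + 2)) * (-8 * int j * coeff y j))] (mod int p)"
    unfolding s(1) by (rule cong_trans[OF d3(2) cong_scalar_left[OF cong_trans[OF d2(2) cong_scalar_left[OF d1(2)]]]])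
  moreover have "[coeff (4 * ode_V * theta y) (j + 6) = (-256) * (-8 * int j * coeff y j)] (mod int p)"
  proof -
    have "degree (4 * ode_V) \<le> 4" "coeff (4 * ode_V) 4 = -256"
      by (simp_all add: ode_V_def ode_P_def numeral_eq_Suc numeral_poly)
    from cong_trans[OF top_coeff_mult(2)[OF d1(1) this(1)] cong_scalar_left[OF d1(2)]] this(2)
    show ?thesis unfolding s(2) by simp
  qed
  moreover have "[coeff (2 * theta ode_V * y) (j + 6) = 4096 * coeff y j] (mod int p)"
  proof -
    have "degree (2 * theta ode_V) \<le> 6" "coeff (2 * theta ode_V) 6 = 4096"
      using deg_theta_V by (simp_all add: numeral_poly)
    from top_coeff_mult(2)[OF assms this(1)] this(2) show ?thesis unfolding s(3) by simp
  qed
  ultimately have "[coeff (L3 y) (j+6) = (-8 * int (j + 2 + 2)) * ((-8 * int (j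
      + 2)) * (-8 * int j * coeff y j))
     - (-256) * (-8 * int j * coeff y j) - 4096 * coeff y j] (mod int p)"
    unfolding L3_def coeff_diff by (intro cong_diff)
  also have "(-8 * int (j + 2 + 2)) * ((-8 * int (j + 2)) * (-8 * int j * coeff y j))
     - (-256) * (-8 * int j * coeff y j) - 4096 * coeff y j = -512 * (int j + 2) ^ 3 * coeff y j"
    by (simp add: power3_eq_cube algebra_simps)
  finally show ?thesis .
qed

text \<open>
  The factor \<open>j\<^sup>3\<close> is invertible for \<open>0 < j < p\<close>, which kills all coefficients below \<open>p\<close> one by one from
  the bottom. The factor \<open>(j + 2)\<^sup>3\<close> is invertible for \<open>p \<le> j < 2p - 2\<close>, which kills the remaining ones from the top.
\<close>
lemma L3_unique:
  assumes p: "prime p" "p > 2" and L: "pcong p (L3 y) 0"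
    and d: "degree y \<le> 2 * p - 2" and c: "int p dvd coeff y 0" "int p dvd coeff y (2 * p - 2)"
  shows "pcong p y 0"
proof -
  have pi: "prime (int p)" using p by simp
  have L0: "int p dvd coeff (L3 y) i" for i using L by (simp add: pcong_iff_coeff cong_0_iff)
  have low: "int p dvd coeff y j" if "j < p" for j
    using that
  proof (induction j rule: less_induct)
    case (less j)
    show ?case
    proof (cases "j = 0")
      case False
      have "int p dvd int j ^ 3 * coeff y j"
      proof -
        have "\<forall>i<j. int p dvd coeff y i" using less by auto
        from cong_dvd_iff[OF lowest_coeff_L3[OF this]] L0 show ?thesis by blast
      qed
      moreover have "\<not> int p dvd int j ^ 3"
      proof
        assume "int p dvd int j ^ 3"
        hence "int p dvd int j" by (rule prime_dvd_power[OF pi])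
        thus False using False less.prems by (auto dest: dvd_imp_le)
      qed
      ultimately show ?thesis using pi by (simp add: prime_dvd_mult_iff)
    qed (use c in auto)
  qed
  have high: "int p dvd coeff y (2 * p - 2 - m)" if "m \<le> p - 2" for m
    using that
  proof (induction m rule: less_induct)
    case (less m)
    show ?case
    proof (cases "m = 0")
      case False
      let ?j = "2 * p - 2 - m"
      have "\<forall>i>?j. int p dvd coeff y i"
      proof (intro allI impI)
        fix i assume i: "i > ?j"
        show "int p dvd coeff y i"
        proof (cases "i \<le> 2 * p - 2")
          case True
          have "int p dvd coeff y (2 * p - 2 - (2 * p - 2 - i))"
            by (rule less.IH) (use i less.prems True in auto)
          moreover have "2 * p - 2 - (2 * p - 2 - i) = i" using True by simp
          ultimately show ?thesis by (simp only:)
        next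
          case False thus ?thesis using d by (simp add: coeff_eq_0)
        qed
      qed
      hence "int p dvd -512 * (int ?j + 2) ^ 3 * coeff y ?j"
        using top_coeff_L3[of ?j p y] L0 cong_dvd_iff by blast
      hence A: "int p dvd (2 * (int ?j + 2)) ^ 9 * coeff y ?j"
      proof -
        \<comment> \<open>Here \<open>512 = 2^9\<close>, so the whole factor becomes a power to which primality applies.\<close>
        have e: "(2 * x) ^ 9 * c = - (x ^ 6) * (-512 * x ^ 3 * c)" for x c :: int
          by (simp add: power_mult_distrib flip: power_add)
        show ?thesis unfolding e by (rule dvd_mult) fact
      qed
      have "\<not> int p dvd 2 * (int ?j + 2)"
      proof
        assume "int p dvd 2 * (int ?j + 2)"
        hence "int p dvd 2 \<or> int p dvd int ?j + 2" by (rule prime_dvd_multD[OF pi])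
        moreover have "\<not> int p dvd 2" using p by (auto dest: zdvd_imp_le)
        ultimately have "int p dvd int (2 * p) - (int ?j + 2)" by (intro dvd_diff) auto
        moreover have "int (2 * p) - (int ?j + 2) = int m" using less.prems p by (simp add: of_nat_diff)
        ultimately have "int p dvd int m" by simp
        hence "p \<le> m" using False by (auto dest: dvd_imp_le)
        thus False using less.prems p by linarith
      qed
      hence "\<not> int p dvd (2 * (int ?j + 2)) ^ 9" using prime_dvd_power[OF pi] by blast
      thus ?thesis using A pi by (simp add: prime_dvd_mult_iff)
    qed (use c in auto)
  qed
  have "int p dvd coeff y i" for i
  proof (cases "i < p")
    case False
    show ?thesis
    proof (cases "i \<le> 2 * p - 2")
      case True
      hence e: "2 * p - 2 - (2 * p - 2 - i) = i" by simp
      have "int p dvd coeff y (2 * p - 2 - (2 * p - 2 - i))" by (rule high) (use False in auto)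
      thus ?thesis by (simp only: e)
    qed (use d in \<open>simp add: coeff_eq_0\<close>)
  qed (rule low)
  thus ?thesis by (simp add: pcong_iff_coeff cong_0_iff)
qed

lemma L3_square:
  assumes "pcong p (theta (theta G)) (ode_V * G)"
  shows "pcong p (L3 (G * G)) 0"
proof -
  have 1: "theta (G * G) = 2 * G * theta G" by (simp add: theta_mult algebra_simps)
  have "theta (theta (G * G)) = 2 * theta G * theta G + 2 * G * theta (theta G)"
    unfolding 1 by (simp add: theta_mult algebra_simps)
  also have "pcong p \<dots> (2 * theta G * theta G + 2 * G * (ode_V * G))"
    by (intro pcong_add pcong_refl pcong_lmult assms)
  finally have "pcong p (theta (theta (theta (G * G)))) (theta (2 * theta G * theta G + 2 * G * (ode_V * G)))"
    by (rule pcong_theta)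
  also have "theta (2 * theta G * theta G + 2 * G * (ode_V * G))
      = 4 * theta G * theta (theta G) + 4 * ode_V * G * theta G + 2 * theta ode_V * (G * G)"
    by (simp add: theta_mult theta_add algebra_simps)
  also have "pcong p \<dots> (4 * theta G * (ode_V * G) + 4 * ode_V * G * theta G + 2 * theta ode_V * (G * G))"
    by (intro pcong_add pcong_refl pcong_lmult assms)
  also have "\<dots> = 4 * ode_V * theta (G * G) + 2 * theta ode_V * (G * G)"
    unfolding 1 by (simp add: algebra_simps)
  finally have "pcong p (theta (theta (theta (G * G))) - (4 * ode_V * theta (G * G)
      + 2 * theta ode_V * (G * G))) 0"
    unfolding pcong_def by simp
  thus ?thesis unfolding L3_def by (simp add: algebra_simps)
qed

text \<open>
  Since \<open>\<theta> (P^k Q^m)\<close> is divisible only by \<open>Q^(m-1)\<close>, iterating \<open>\<theta>\<close> on a term of the Clausen sum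
  would lower the exponent of \<open>Q\<close>. The derivation \<open>Q \<theta>\<close> avoids this: it multiplies \<open>P^k Q^(2(n-k))\<close>,
  modulo \<open>p = 2n + 1\<close>, by \<open>k * ode_R + ode_C\<close>.
\<close>
definition Qtheta :: "int poly \<Rightarrow> int poly" where "Qtheta y = ode_Q * theta y"
definition ode_R :: "int poly" where "ode_R = pderiv ode_P * ode_Q - 2 * ode_P * pderiv ode_Q"
definition ode_C :: "int poly" where "ode_C = - (ode_P * pderiv ode_Q)"

lemma Qtheta_add: "Qtheta (a + b) = Qtheta a + Qtheta b" by (simp add: Qtheta_def theta_add algebra_simps)
lemma Qtheta_mult: "Qtheta (a * b) = a * Qtheta b + Qtheta a * b"
    by (simp add: Qtheta_def theta_mult algebra_simps)
lemma Qtheta_of_nat_mult: "Qtheta (of_nat k * b) = of_nat k * Qtheta b"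
    by (simp add: Qtheta_def theta_mult algebra_simps)
lemma pcong_Qtheta: "pcong p A B \<Longrightarrow> pcong p (Qtheta A) (Qtheta B)"
  unfolding Qtheta_def by (intro pcong_lmult pcong_theta)

lemma L3_via_Qtheta:
  "ode_Q ^ 5 * L3 y = ode_Q ^ 2 * Qtheta (Qtheta (Qtheta y)) - 3 * Qtheta ode_Q * ode_Q * Qtheta (Qtheta y)
      - (ode_Q * Qtheta (Qtheta ode_Q) - 3 * Qtheta ode_Q ^ 2) * Qtheta y
      - 4 * ode_V * ode_Q ^ 4 * Qtheta y - 2 * theta ode_V * ode_Q ^ 5 * y"
  unfolding L3_def Qtheta_def
  by (simp add: theta_mult theta_add eval_nat_numeral algebra_simps)

text \<open>
  Sorted by powers of \<open>k\<close>, the action of \<open>L3\<close> on \<open>P^k Q^(2(n-k))\<close> amounts to four identities between explicit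
  polynomials in \<open>z\<close>. They say that the substitution of \<open>P / Q\<^sup>2\<close> turns \<open>L3\<close> into the
  differential equation of the generating function of \<open>(2k choose k) * f k\<close>.
\<close>
lemma L3_term_identities:
  defines "W \<equiv> ode_Q * Qtheta (Qtheta ode_Q) - 3 * Qtheta ode_Q ^ 2"
  shows "ode_Q^2 * ode_R^3 = ode_Q^2 * ode_R * (ode_Q^4 - 28 * ode_P * ode_Q^2 - 128 * ode_P^2)" (is ?t3)
    and "3 * ode_Q^2 * ode_R^2 * ode_C + 3 * ode_Q^2 * ode_R * Qtheta ode_R - 3 * Qtheta ode_Q * ode_Q * ode_R^2
           = ode_Q^2 * ode_R * (- 42 * ode_P * ode_Q^2 - 384 * ode_P^2)" (is ?t2)
    and "3 * ode_Q^2 * ode_R * ode_C^2 + 3 * ode_Q^2 * ode_R * Qtheta ode_C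
        + 3 * ode_Q^2 * ode_C * Qtheta ode_R + ode_Q^2 * Qtheta (Qtheta ode_R) - W * ode_R
           - 6 * Qtheta ode_Q * ode_Q * ode_R * ode_C - 3 * Qtheta ode_Q * ode_Q * Qtheta ode_R
           - 4 * ode_V * ode_Q^4 * ode_R
           = ode_Q^2 * ode_R * (- 22 * ode_P * ode_Q^2 - 352 * ode_P^2)" (is ?t1)
    and "ode_Q^2 * ode_C^3 + 3 * ode_Q^2 * ode_C * Qtheta ode_C + ode_Q^2 * Qtheta (Qtheta ode_C)
        - W * ode_C - 3 * Qtheta ode_Q * ode_Q * ode_C^2
           - 3 * Qtheta ode_Q * ode_Q * Qtheta ode_C - 4 * ode_V * ode_Q^4 * ode_C - 2 * theta ode_V * ode_Q^5
           = ode_Q^2 * ode_R * (- 4 * ode_P * ode_Q^2 - 96 * ode_P^2)" (is ?t0)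
proof -
  have R: "ode_R = [:1, -14, -48, 112, 64:]"
    by (simp add: ode_R_def ode_P_def ode_Q_def pderiv_pCons numeral_poly)
  have C: "ode_C = [:0, 0, -16, 112, 128:]"
    by (simp add: ode_C_def ode_P_def ode_Q_def pderiv_pCons)
  note c = W_def R C ode_P_def ode_Q_def ode_V_def Qtheta_def theta_def pderiv_pCons numeral_poly
  show ?t3 unfolding c by (simp add: eval_nat_numeral pderiv_pCons)
  show ?t2 unfolding c by (simp add: eval_nat_numeral pderiv_pCons)
  show ?t1 unfolding c by (simp add: eval_nat_numeral pderiv_pCons)
  show ?t0 unfolding c by (simp add: eval_nat_numeral pderiv_pCons)
qed

lemma Qtheta_monomial:
  "Qtheta (ode_P ^ k * ode_Q ^ m) = (of_nat k * (pderiv ode_P * ode_Q)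
      + of_nat m * (ode_P * pderiv ode_Q)) * (ode_P ^ k * ode_Q ^ m)"
proof -
  have 1: "theta (ode_P ^ k) = of_nat k * pderiv ode_P * ode_P ^ k" for k
  proof (induction k)
    case (Suc k)
    have "theta ode_P = ode_P * pderiv ode_P" by (simp add: theta_def)
    with Suc show ?case by (simp add: theta_mult algebra_simps)
  qed simp
  have 2: "ode_Q * theta (ode_Q ^ m) = of_nat m * (ode_P * pderiv ode_Q) * ode_Q ^ m" for m
  proof (induction m)
    case (Suc m)
    have "ode_Q * theta (ode_Q ^ Suc m) = ode_Q * (ode_Q * theta (ode_Q ^ m))
        + ode_Q * (theta ode_Q * ode_Q ^ m)"
      by (simp add: theta_mult algebra_simps)
    also have "\<dots> = of_nat (Suc m) * (ode_P * pderiv ode_Q) * ode_Q ^ Suc m"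
      unfolding Suc by (simp add: theta_def algebra_simps)
    finally show ?case .
  qed simp
  have "Qtheta (ode_P ^ k * ode_Q ^ m) = ode_P ^ k * (ode_Q * theta (ode_Q ^ m))
      + ode_Q * theta (ode_P ^ k) * ode_Q ^ m"
    unfolding Qtheta_def theta_mult by (simp add: algebra_simps)
  thus ?thesis unfolding 1 2 by (simp add: algebra_simps)
qed

text \<open>
  The two polynomials in \<open>K\<close> on the right are the coefficients of the recurrence for
  \<open>(2k choose k) * f k\<close> (see \<open>central_franel_recurrence\<close>), so that summation over \<open>k\<close> will telescope.
\<close>
lemma L3_term:
  assumes p: "p = 2 * n + 1" and k: "k \<le> n"
  defines "T \<equiv> ode_P ^ k * ode_Q ^ (2 * (n - k))" and "K \<equiv> (of_nat k :: int poly)"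
  shows "pcong p (ode_Q ^ 5 * L3 T) (ode_Q ^ 2 * ode_R * (K ^ 3 * ode_Q ^ 4
      - (28 * K^3 + 42 * K^2 + 22 * K + 4) * ode_P * ode_Q ^ 2
            - (128 * K^3 + 384 * K^2 + 352 * K + 96) * ode_P ^ 2) * T)"
proof -
  define a where "a = K * ode_R + ode_C"
  have "Qtheta T = (K * (pderiv ode_P * ode_Q) + of_nat (2 * (n - k)) * (ode_P * pderiv ode_Q)) * T"
    unfolding T_def K_def by (rule Qtheta_monomial)
  also have "K * (pderiv ode_P * ode_Q) + of_nat (2 * (n - k)) * (ode_P * pderiv ode_Q)
      = a + of_nat p * (ode_P * pderiv ode_Q)"
    using k by (simp add: a_def ode_R_def ode_C_def p K_def of_nat_diff algebra_simps)
  also have "pcong p (\<dots> * T) (a * T)"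
    unfolding pcong_def by (rule dvdI[of _ _ "(ode_P * pderiv ode_Q)
        * T"]) (simp add: of_nat_poly algebra_simps)
  finally have e1: "pcong p (Qtheta T) (a * T)" .
  have "pcong p (Qtheta (Qtheta T)) (Qtheta (a * T))" by (rule pcong_Qtheta[OF e1])
  also have "Qtheta (a * T) = a * Qtheta T + Qtheta a * T" by (rule Qtheta_mult)
  also have "pcong p \<dots> (a * (a * T) + Qtheta a * T)" by (intro pcong_add pcong_lmult e1 pcong_refl)
  also have "\<dots> = (a^2 + Qtheta a) * T" by (simp add: power2_eq_square algebra_simps)
  finally have e2: "pcong p (Qtheta (Qtheta T)) ((a^2 + Qtheta a) * T)" .
  have "pcong p (Qtheta (Qtheta (Qtheta T))) (Qtheta ((a^2 + Qtheta a) * T))" by (rule pcong_Qtheta[OF e2])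
  also have "Qtheta ((a^2 + Qtheta a) * T) = (a^2 + Qtheta a) * Qtheta T + (2 * a * Qtheta a
      + Qtheta (Qtheta a)) * T" 
    by (simp add: Qtheta_mult Qtheta_add power2_eq_square algebra_simps)
  also have "pcong p \<dots> ((a^2 + Qtheta a) * (a * T) + (2 * a * Qtheta a + Qtheta (Qtheta a)) * T)"
    by (intro pcong_add pcong_lmult e1 pcong_refl)
  also have "\<dots> = (a^3 + 3 * a * Qtheta a + Qtheta (Qtheta a)) * T"
    by (simp add: power2_eq_square power3_eq_cube algebra_simps)
  finally have e3: "pcong p (Qtheta (Qtheta (Qtheta T))) ((a^3 + 3 * a * Qtheta a + Qtheta (Qtheta a)) * T)" .
  define W where "W = ode_Q * Qtheta (Qtheta ode_Q) - 3 * Qtheta ode_Q ^ 2"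
  have "pcong p (ode_Q ^ 5 * L3 T) (ode_Q ^ 2 * ((a^3 + 3 * a * Qtheta a + Qtheta (Qtheta a)) * T)
      - 3 * Qtheta ode_Q * ode_Q * ((a^2 + Qtheta a) * T) - W * (a * T)
      - 4 * ode_V * ode_Q ^ 4 * (a * T) - 2 * theta ode_V * ode_Q ^ 5 * T)"
    unfolding L3_via_Qtheta W_def[symmetric] by (intro pcong_diff pcong_lmult e1 e2 e3 pcong_refl)
  also have "\<dots> = (ode_Q ^ 2 * (a^3 + 3 * a * Qtheta a + Qtheta (Qtheta a))
      - 3 * Qtheta ode_Q * ode_Q * (a^2 + Qtheta a) - W * a
       - 4 * ode_V * ode_Q ^ 4 * a - 2 * theta ode_V * ode_Q ^ 5) * T" by (simp add: algebra_simps)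
  also have "ode_Q ^ 2 * (a^3 + 3 * a * Qtheta a + Qtheta (Qtheta a))
      - 3 * Qtheta ode_Q * ode_Q * (a^2 + Qtheta a) - W * a
       - 4 * ode_V * ode_Q ^ 4 * a - 2 * theta ode_V * ode_Q ^ 5 =
      K^3 * (ode_Q^2 * ode_R^3)
    + K^2 * (3 * ode_Q^2 * ode_R^2 * ode_C + 3 * ode_Q^2 * ode_R * Qtheta ode_R
    - 3 * Qtheta ode_Q * ode_Q * ode_R^2)
    + K * (3 * ode_Q^2 * ode_R * ode_C^2 + 3 * ode_Q^2 * ode_R * Qtheta ode_C
    + 3 * ode_Q^2 * ode_C * Qtheta ode_R + ode_Q^2 * Qtheta (Qtheta ode_R) - W * ode_R
           - 6 * Qtheta ode_Q * ode_Q * ode_R * ode_C - 3 * Qtheta ode_Q * ode_Q * Qtheta ode_R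
           - 4 * ode_V * ode_Q^4 * ode_R)
    + (ode_Q^2 * ode_C^3 + 3 * ode_Q^2 * ode_C * Qtheta ode_C + ode_Q^2 * Qtheta (Qtheta ode_C)
    - W * ode_C - 3 * Qtheta ode_Q * ode_Q * ode_C^2
           - 3 * Qtheta ode_Q * ode_Q * Qtheta ode_C - 4 * ode_V * ode_Q^4 * ode_C - 2 * theta ode_V * ode_Q^5)"
  proof -
    have "Qtheta a = K * Qtheta ode_R + Qtheta ode_C" "Qtheta (Qtheta a)
        = K * Qtheta (Qtheta ode_R) + Qtheta (Qtheta ode_C)"
      unfolding a_def K_def by (simp_all add: Qtheta_add Qtheta_of_nat_mult)
    thus ?thesis unfolding a_def by (simp add: power2_eq_square power3_eq_cube algebra_simps)
  qed
  also have "\<dots> = ode_Q ^ 2 * ode_R * (K ^ 3 * ode_Q ^ 4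
      - (28 * K^3 + 42 * K^2 + 22 * K + 4) * ode_P * ode_Q ^ 2
            - (128 * K^3 + 384 * K^2 + 352 * K + 96) * ode_P ^ 2)"
    unfolding W_def L3_term_identities by (simp add: algebra_simps)
  finally show ?thesis .
qed

section \<open>A Clausen formula modulo p\<close>

lemma franel_recurrence:
  "(n + 2)^2 * franel (n + 2) = (7 * n^2 + 21 * n + 16) * franel (n + 1) + 8 * (n + 1)^2 * franel n"
proof -
  have "real ((n + 2)^2 * franel (n + 2)) = real ((7 * n^2 + 21 * n + 16) * franel (n + 1) + 8 * (n
      + 1)^2 * franel n)"
    using franel_recurrence_aux[of n] by (simp add: algebra_simps power2_eq_square)
  thus ?thesis by (simp only: of_nat_eq_iff)
qed

lemma central_binomial_Suc: "Suc m * ((2 * Suc m) choose Suc m) = 2 * (2 * m + 1) * ((2 * m) choose m)"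
proof -
  have "Suc m * (Suc (2 * m + 1) choose Suc m) = Suc (2 * m + 1) * ((2 * m + 1) choose m)"
    by (rule Suc_times_binomial)
  moreover have "(2 * m + 1) choose m = (2 * m + 1) choose Suc m"
    using binomial_symmetric[of m "2 * m + 1"] by simp
  moreover have "Suc m * (Suc (2 * m) choose Suc m) = Suc (2 * m) * ((2 * m) choose m)"
    by (rule Suc_times_binomial)
  moreover have "Suc (2 * m + 1) = 2 * Suc m" "Suc (2 * m) = 2 * m + 1" by simp_all
  ultimately have "Suc m * ((2 * Suc m) choose Suc m) = 2 * (Suc m * ((2 * m + 1) choose Suc m))"
      and "Suc m * ((2 * m + 1) choose Suc m) = (2 * m + 1) * ((2 * m) choose m)"
    by (simp_all only: mult.assoc)
  thus ?thesis by (simp only: mult.assoc)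
qed

definition central_franel :: "nat \<Rightarrow> nat" where "central_franel k = ((2 * k) choose k) * franel k"

lemma franel_0 [simp]: "franel 0 = 1" and franel_1 [simp]: "franel (Suc 0) = 2"
  by (simp_all add: franel_def)

lemma central_franel_recurrence:
  "(n + 2) ^ 3 * central_franel (n + 2) = (28 * (n+1)^3 + 42 * (n+1)^2 + 22 * (n+1)
      + 4) * central_franel (n + 1)
      + (128 * n^3 + 384 * n^2 + 352 * n + 96) * central_franel n"
proof -
  define c where "c m = (2 * m) choose m" for m :: nat
  have c: "(m + 1) * c (m + 1) = 2 * (2 * m + 1) * c m" for m
    using central_binomial_Suc[of m] by (simp add: c_def)
  have central_franel: "central_franel m = c m * franel m" for m by (simp add: central_franel_def c_def)
  have "(n + 2) ^ 3 * central_franel (n + 2) = ((n + 1 + 1) * c (n + 1 + 1)) * ((n + 2) ^ 2 * franel (n + 2))"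
    by (simp add: central_franel power2_eq_square power3_eq_cube algebra_simps)
  also have "\<dots> = 2 * (2 * n + 3) * c (n + 1) * ((7 * n^2 + 21 * n + 16) * franel (n + 1) + 8 * (n
      + 1)^2 * franel n)"
    unfolding c[of "n + 1"] franel_recurrence by (simp add: algebra_simps)
  also have "\<dots> = 2 * (2 * n + 3) * (7 * n^2 + 21 * n + 16) * (c (n + 1) * franel (n + 1))
       + 16 * (2 * n + 3) * (n + 1) * ((n + 1) * c (n + 1)) * franel n"
    by (simp add: algebra_simps power2_eq_square)
  also have "\<dots> = 2 * (2 * n + 3) * (7 * n^2 + 21 * n + 16) * central_franel (n + 1)
       + 32 * (2 * n + 3) * (n + 1) * (2 * n + 1) * central_franel n"
    unfolding c[of n] central_franel by (simp add: algebra_simps)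
  finally show ?thesis by (simp add: algebra_simps power2_eq_square power3_eq_cube)
qed

text \<open>
  Applying \<open>L3\<close> to the Clausen sum produces this expression, with \<open>U k = P^k Q^(2(n+2-k))\<close>. The recurrence
  cancels everything except two boundary terms. Both of their coefficients are multiples of \<open>2N + 1\<close>, so that
  they vanish modulo \<open>p = 2n + 1\<close> for \<open>N = n\<close>.
\<close>
lemma central_franel_telescope:
  fixes U :: "nat \<Rightarrow> 'a :: comm_ring_1"
  shows "(\<Sum>k\<le>N. of_nat (central_franel k) * (of_nat k ^ 3 * U k
            - (28 * of_nat k ^ 3 + 42 * of_nat k ^ 2 + 22 * of_nat k + 4) * U (k + 1)
            - (128 * of_nat k ^ 3 + 384 * of_nat k ^ 2 + 352 * of_nat k + 96) * U (k + 2)))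
       = - (of_nat ((N + 1) ^ 3 * central_franel (N + 1)) * U (N + 1))
         - (of_nat ((128 * N^3 + 384 * N^2 + 352 * N + 96) * central_franel N) * U (N + 2))"
proof (induction N)
  case 0
  show ?case by (simp add: central_franel_def)
next
  case (Suc N)
  show ?case unfolding sum.atMost_Suc Suc.IH
    using arg_cong[OF central_franel_recurrence[of N], of "of_nat :: nat \<Rightarrow> 'a"]
    by (simp add: algebra_simps)
qed

definition clausen_sum :: "nat \<Rightarrow> int poly" where
  "clausen_sum n = (\<Sum>k\<le>n. of_nat (central_franel k) * (ode_P ^ k * ode_Q ^ (2 * (n - k))))"
definition franel_poly :: "nat \<Rightarrow> int poly" where
  "franel_poly p = (\<Sum>k<p. monom (int (franel k)) k)"

lemma L3_clausen_sum:
  assumes "prime p" and p: "p = 2 * n + 1"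
  shows "pcong p (L3 (clausen_sum n)) 0"
proof -
  define U where "U k = ode_P ^ k * ode_Q ^ (2 * (n + 2 - k))" for k
  have L3_of_nat: "L3 (of_nat c * y) = of_nat c * L3 y" for c y
    by (simp add: L3_def theta_mult algebra_simps)
  have "ode_Q ^ 5 * L3 (clausen_sum n) = (\<Sum>k\<le>n. of_nat (central_franel k) * (ode_Q ^ 5
      * L3 (ode_P ^ k * ode_Q ^ (2 * (n - k)))))"
    unfolding clausen_sum_def L3_sum sum_distrib_left L3_of_nat by (simp add: algebra_simps)
  also have "pcong p \<dots> (\<Sum>k\<le>n. of_nat (central_franel k) * (ode_Q ^ 2 * ode_R
      * (of_nat k ^ 3 * ode_Q ^ 4
            - (28 * of_nat k ^3 + 42 * of_nat k^2 + 22 * of_nat k + 4) * ode_P * ode_Q ^ 2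
            - (128 * of_nat k ^3 + 384 * of_nat k ^2 + 352 * of_nat k
            + 96) * ode_P ^ 2) * (ode_P ^ k * ode_Q ^ (2 * (n - k)))))"
    by (intro pcong_sum pcong_lmult L3_term p) auto
  also have "\<dots> = ode_Q ^ 2 * ode_R * (\<Sum>k\<le>n. of_nat (central_franel k) * (of_nat k ^ 3 * U k
            - (28 * of_nat k ^ 3 + 42 * of_nat k ^ 2 + 22 * of_nat k + 4) * U (k + 1)
            - (128 * of_nat k ^ 3 + 384 * of_nat k ^ 2 + 352 * of_nat k + 96) * U (k + 2)))"
    unfolding sum_distrib_left
  proof (intro sum.cong refl)
    fix k assume "k \<in> {..n}"
    then obtain m where m: "n = k + m" using le_Suc_ex by auto
    have "n - k = m" "n + 2 - k = m + 2" "n + 2 - (k + 1) = m + 1" "n + 2 - (k + 2) = m" using m by auto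
    hence U: "U k = ode_Q ^ 4 * (ode_P ^ k * ode_Q ^ (2 * m))" "U (k + 1)
        = ode_P * ode_Q ^ 2 * (ode_P ^ k * ode_Q ^ (2 * m))"
        "U (k + 2) = ode_P ^ 2 * (ode_P ^ k * ode_Q ^ (2 * m))" and nk: "n - k = m"
      by (simp_all add: U_def power_add eval_nat_numeral)
    show "of_nat (central_franel k) * (ode_Q ^ 2 * ode_R * (of_nat k ^ 3 * ode_Q ^ 4
            - (28 * of_nat k ^3 + 42 * of_nat k^2 + 22 * of_nat k + 4) * ode_P * ode_Q ^ 2
            - (128 * of_nat k ^3 + 384 * of_nat k ^2 + 352 * of_nat k
            + 96) * ode_P ^ 2) * (ode_P ^ k * ode_Q ^ (2 * (n - k))))
       = ode_Q ^ 2 * ode_R * (of_nat (central_franel k) * (of_nat k ^ 3 * U k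
            - (28 * of_nat k ^ 3 + 42 * of_nat k ^ 2 + 22 * of_nat k + 4) * U (k + 1)
            - (128 * of_nat k ^ 3 + 384 * of_nat k ^ 2 + 352 * of_nat k + 96) * U (k + 2)))"
      unfolding U nk by (simp add: algebra_simps)
  qed
  also have "\<dots> = ode_Q ^ 2 * ode_R * (- (of_nat ((n + 1) ^ 3 * central_franel (n + 1)) * U (n + 1))
         - (of_nat ((128 * n^3 + 384 * n^2 + 352 * n + 96) * central_franel n) * U (n + 2)))"
    unfolding central_franel_telescope ..
  also have "pcong p \<dots> (ode_Q ^ 2 * ode_R * 0)"
  proof (rule pcong_lmult)
    have "(n + 1) ^ 3 * central_franel (n + 1) = p * (2 * (n + 1)^2 * ((2 * n) choose n) * franel (n + 1))"
    proof -
      have "(n + 1) ^ 3 * central_franel (n + 1) = (n + 1)^2 * (Suc n * ((2 * Suc n) choose Suc n))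
          * franel (n + 1)"
        by (simp only: central_franel_def power3_eq_cube power2_eq_square Suc_eq_plus1 mult_ac)
      thus ?thesis unfolding central_binomial_Suc p by (simp add: algebra_simps)
    qed
    moreover have "(128 * n^3 + 384 * n^2 + 352 * n + 96) * central_franel n
        = p * (32 * (n + 1) * (2 * n + 3) * central_franel n)"
      unfolding p by (simp add: algebra_simps power2_eq_square power3_eq_cube)
    moreover have "[:int p:] dvd (of_nat (p * c) :: int poly)" for c
      by (simp add: of_nat_poly)
    ultimately show "pcong p (- (of_nat ((n + 1) ^ 3 * central_franel (n + 1)) * U (n + 1))
         - (of_nat ((128 * n^3 + 384 * n^2 + 352 * n + 96) * central_franel n) * U (n + 2))) 0"
      unfolding pcong_def by (metis diff_zero dvd_diff dvd_minus_iff dvd_mult2)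
  qed
  finally have "pcong p (ode_Q ^ 5 * L3 (clausen_sum n)) (ode_Q ^ 5 * 0)" by simp
  moreover have "\<not> [:int p:] dvd ode_Q ^ 5"
  proof -
    have "prime_elem [:int p:]" using assms(1) by (simp add: prime_elem_const_poly_iff)
    moreover have "\<not> [:int p:] dvd ode_Q" using assms(1) 
      by (auto simp: ode_Q_def const_poly_dvd_iff intro!: exI[of _ 0] dest: zdvd1_eq[THEN iffD1] prime_gt_1_nat)
    ultimately show ?thesis by (metis prime_elem_dvd_power)
  qed
  ultimately show ?thesis using assms(1) pcong_cancel by blast
qed

lemma coeff_franel_poly: "coeff (franel_poly p) i = (if i < p then int (franel i) else 0)"
  by (simp add: franel_poly_def coeff_sum coeff_monom)

text \<open>
  Truncating at degree \<open>p - 1\<close> costs nothing modulo \<open>p\<close>: in degrees \<open>p - 1\<close> and \<open>p\<close>, where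
  the recurrence is cut off, the missing or surplus term carries a factor \<open>p\<^sup>2\<close>.
\<close>
lemma franel_poly_ode:
  assumes "prime p" 
  shows "pcong p (theta (theta (franel_poly p))) (ode_V * franel_poly p)"
proof -
  have p1: "p > 1" using assms prime_gt_1_nat by blast
  have r: "int (n + 2)^2 * int (franel (n + 2)) = (7 * int n^2 + 21 * int n + 16) * int (franel (n + 1)) 
     + 8 * (int n + 1)^2 * int (franel n)" for n
    using arg_cong[OF franel_recurrence[of n], of int] by (simp add: algebra_simps)
  have "pcong p (pderiv (theta (franel_poly p))) ([:2, 8:] * franel_poly p)"
    unfolding pcong_iff_coeff
  proof
    fix i
    have R: "coeff ([:2, 8:] * franel_poly p) i = 2 * coeff (franel_poly p) i + (if i
        = 0 then 0 else 8 * coeff (franel_poly p) (i - 1))"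
      by (cases i) (auto simp: coeff_pCons)
    show "[coeff (pderiv (theta (franel_poly p))) i = coeff ([:2, 8:] * franel_poly p) i] (mod int p)"
    proof (cases i)
      case 0
      show ?thesis unfolding R coeff_pderiv coeff_theta coeff_franel_poly using p1 by (simp add: 0)
    next
      case (Suc m)
      have e: "coeff (pderiv (theta (franel_poly p))) i - coeff ([:2, 8:] * franel_poly p) i =
         (int m + 2) * ((int m + 2) * coeff (franel_poly p) (m + 2)
             - 7 * (int m + 1) * coeff (franel_poly p) (m + 1) - 8 * int m * coeff (franel_poly p) m)
          - 2 * coeff (franel_poly p) (m + 1) - 8 * coeff (franel_poly p) m"
        unfolding R coeff_pderiv coeff_theta by (simp add: Suc algebra_simps)
      consider "m + 2 < p" | "m + 2 = p" | "m + 1 = p" | "m \<ge> p" by linarith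
      hence "int p dvd coeff (pderiv (theta (franel_poly p))) i - coeff ([:2, 8:] * franel_poly p) i"
      proof cases
        case 1
        have "coeff (pderiv (theta (franel_poly p))) i - coeff ([:2, 8:] * franel_poly p) i = 0"
          unfolding e coeff_franel_poly using 1 r[of m] by (simp add: algebra_simps power2_eq_square)
        thus ?thesis by simp
      next
        case 2
        have "coeff (pderiv (theta (franel_poly p))) i - coeff ([:2, 8:] * franel_poly p) i
            = - (int p * (int p * int (franel p)))"
          unfolding e coeff_franel_poly using 2 r[of m] by (simp add: algebra_simps power2_eq_square flip: 2)
        thus ?thesis by simp
      next
        case 3
        have "coeff (pderiv (theta (franel_poly p))) i - coeff ([:2, 8:] * franel_poly p) i
            = - (int p * (8 * int p * int (franel m)))"
          unfolding e coeff_franel_poly by (simp add: algebra_simps power2_eq_square flip: 3)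
        thus ?thesis by simp
      next
        case 4
        thus ?thesis unfolding e coeff_franel_poly by simp
      qed
      thus ?thesis by (simp add: cong_iff_dvd_diff)
    qed
  qed
  hence "pcong p (ode_P * pderiv (theta (franel_poly p))) (ode_P * ([:2, 8:] * franel_poly p))"
      by (rule pcong_lmult)
  thus ?thesis unfolding ode_V_def by (simp only: theta_def mult.assoc mult.commute mult.left_commute)
qed

lemma franel_pos: "franel n > 0"
proof -
  have "(\<Sum>k\<in>{0}. (n choose k) ^ 3) \<le> (\<Sum>k\<le>n. (n choose k) ^ 3)" by (rule sum_mono2) auto
  thus ?thesis unfolding franel_def by simp
qed

lemma choose_prime_pred:
  assumes "prime p" "k < p"
  shows "[int ((p - 1) choose k) = (-1) ^ k] (mod int p)"
  using assms(2)
proof (induction k)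
  case (Suc k)
  have p: "Suc (p - 1) = p" using assms by simp
  have "p choose Suc k = ((p - 1) choose k) + ((p - 1) choose Suc k)"
    using binomial_Suc_Suc[of "p - 1" k] unfolding p by simp
  moreover have "p dvd p choose Suc k" using assms(1) Suc.prems by (intro dvd_choose_prime) auto
  ultimately have "int p dvd int ((p - 1) choose k) + int ((p - 1) choose Suc k)"
    by (metis of_nat_add of_nat_dvd_iff)
  hence "[int ((p - 1) choose Suc k) = - int ((p - 1) choose k)] (mod int p)"
    by (simp add: cong_iff_dvd_diff add.commute)
  also have "[- int ((p - 1) choose k) = - ((-1) ^ k)] (mod int p)"
    using Suc by (simp add: cong_minus_minus_iff)
  finally show ?case by simp
qed simp

lemma franel_prime_pred:
  assumes "prime p" "odd p"
  shows "[int (franel (p - 1)) = 1] (mod int p)"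
proof -
  have "[int (franel (p - 1)) = (\<Sum>k\<le>p-1. ((-1) ^ k) ^ 3)] (mod int p)"
    unfolding franel_def of_nat_sum of_nat_power
    using assms prime_gt_0_nat[of p] by (intro cong_sum cong_pow choose_prime_pred) auto
  also have "(\<Sum>k\<le>p-1. (((-1)::int) ^ k) ^ 3) = (\<Sum>k\<le>p-1. (-1) ^ k)"
    by (intro sum.cong) (auto simp: power3_eq_cube uminus_power_if)
  also have "\<dots> = 1"
  proof -
    have "(\<Sum>k\<le>2*m. ((-1)::int) ^ k) = 1" for m by (induction m) auto
    moreover from assms obtain m where "p - 1 = 2 * m" by
        (metis odd_two_times_div_two_nat dvd_triv_left oddE add_diff_cancel_right')
    ultimately show ?thesis by simp
  qed
  finally show ?thesis .
qed

text \<open>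
  Both sides are solutions of \<open>L3\<close> modulo \<open>p\<close>, so by \<open>L3_unique\<close> two coefficients have to be compared.
  The constant terms are \<open>1\<close>. In degree \<open>2p - 2\<close> only \<open>Q^(p-1)\<close> contributes on the left, with
  coefficient \<open>8^(p-1)\<close>; on the right there is \<open>(f (p-1))\<^sup>2\<close>, and \<open>f (p-1)\<close> is congruent to
  the sum of the signs \<open>(-1)^k\<close>.
\<close>
theorem clausen_franel:
  assumes "prime p" and p: "p = 2 * n + 1"
  shows "pcong p (clausen_sum n) (franel_poly p * franel_poly p)"
proof -
  have p2: "p > 2" using assms prime_gt_1_nat[of p] by auto
  have n0: "n > 0" using p p2 by simp
  let ?y = "clausen_sum n - franel_poly p * franel_poly p"
  have "pcong p ?y 0"
  proof (rule L3_unique[OF assms(1) p2])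
    show "pcong p (L3 ?y) 0" unfolding L3_diff
      using pcong_diff[OF L3_clausen_sum[OF assms] L3_square[OF franel_poly_ode[OF assms(1)]]] by simp
    have dG: "degree (franel_poly p) = 2 * n"
    proof (rule antisym)
      show "degree (franel_poly p) \<le> 2 * n" by (rule degree_le) (auto simp: coeff_franel_poly p)
      show "2 * n \<le> degree (franel_poly p)" by (rule le_degree) (use franel_pos[of "2
          * n"] in \<open>auto simp: coeff_franel_poly p\<close>)
    qed
    have dT: "degree (ode_P ^ k * ode_Q ^ (2 * (n - k))) \<le> 4 * n - k" if "k \<le> n" for k
    proof -
      have "degree ode_P = 3" "degree ode_Q = 2" by (simp_all add: ode_P_def ode_Q_def)
      hence "degree (ode_P ^ k * ode_Q ^ (2 * (n - k))) = 3 * k + 2 * (2 * (n - k))"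
        by (subst degree_mult_eq) (auto simp: ode_P_def ode_Q_def degree_power_eq)
      thus ?thesis using that by simp
    qed
    have oc: "degree ((of_nat c :: int poly) * y) \<le> degree y" "coeff ((of_nat c :: int poly) * y) i
        = int c * coeff y i" for c y i
      by (simp_all add: of_nat_poly)
    have "degree (clausen_sum n) \<le> 4 * n" unfolding clausen_sum_def
    proof (intro degree_sum_le)
      fix k assume "k \<in> {..n}"
      thus "degree (of_nat (central_franel k) * (ode_P ^ k * ode_Q ^ (2 * (n - k)))) \<le> 4 * n"
        using order_trans[OF oc(1) order_trans[OF dT[of k] diff_le_self]] by simp
    qed simp
    moreover have "degree (franel_poly p * franel_poly p) \<le> 4
        * n" using degree_mult_le[of "franel_poly p" "franel_poly p"] dG by simp
    moreover have e: "2 * p - 2 = 4 * n" by (simp add: p)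
    ultimately show "degree ?y \<le> 2 * p - 2" by (simp add: degree_diff_le)
    show "int p dvd coeff ?y 0"
    proof -
      have "poly ode_P 0 = 0" "poly ode_Q 0 = 1" by (simp_all add: ode_P_def ode_Q_def)
      hence "poly (clausen_sum n) 0 = (\<Sum>k\<le>n. if k = 0 then 1 else 0)"
        unfolding clausen_sum_def poly_sum by (intro sum.cong) (auto simp: central_franel_def)
      hence "coeff (clausen_sum n) 0 = 1" by (simp add: poly_0_coeff_0)
      moreover have "coeff (franel_poly p * franel_poly p) 0 = 1" using p2
          by (simp add: coeff_mult_0 coeff_franel_poly)
      ultimately show ?thesis by simp
    qed
    show "int p dvd coeff ?y (2 * p - 2)"
    proof -
      have "coeff (clausen_sum n) (4 * n) = (\<Sum>k\<le>n. if k = 0 then 8 ^ (2 * n) else 0)"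
        unfolding clausen_sum_def coeff_sum
      proof (intro sum.cong refl)
        fix k assume k: "k \<in> {..n}"
        show "coeff (of_nat (central_franel k) * (ode_P ^ k * ode_Q ^ (2 * (n - k)))) (4 * n) = (if k
            = 0 then 8 ^ (2 * n) else 0)"
        proof (cases "k = 0")
          case True
          have "degree ode_Q = 2" "lead_coeff ode_Q = 8" by (simp_all add: ode_Q_def)
          hence "coeff (ode_Q ^ (2 * n)) (4 * n) = 8 ^ (2 * n)"
            using lead_coeff_power[of ode_Q "2 * n"] by (simp add: degree_power_eq ode_Q_def mult.assoc)
          thus ?thesis using True by (simp add: central_franel_def)
        next
          case False
          have "coeff (ode_P ^ k * ode_Q ^ (2 * (n - k))) (4 * n) = 0"
            using dT[of k] k False n0 by (intro coeff_eq_0) auto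
          thus ?thesis using False by (simp add: oc)
        qed
      qed
      hence "coeff (clausen_sum n) (4 * n) = 8 ^ (2 * n)" by simp
      moreover have "coeff (franel_poly p * franel_poly p) (4 * n) = int (franel (p - 1)) ^ 2"
        using coeff_mult_degree_sum[of "franel_poly p" "franel_poly p"] dG
            by (simp add: coeff_franel_poly p power2_eq_square)
      moreover have "[(8::int) ^ (2 * n) = 1] (mod int p)"
      proof -
        have "\<not> p dvd 2 ^ 3"
        proof
          assume "p dvd 2 ^ 3"
          hence "p dvd 2" by (rule prime_dvd_power[OF assms(1)])
          hence "p \<le> 2" by (rule dvd_imp_le) simp
          thus False using p2 by simp
        qed
        hence "\<not> p dvd 8" by simp
        hence "[8 ^ (p - 1) = 1] (mod p)" using assms(1) by (rule fermat_theorem[rotated])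
        hence "[int (8 ^ (p - 1)) = int 1] (mod int p)" by (simp only: cong_int_iff)
        thus ?thesis by (simp add: p)
      qed
      moreover have "[int (franel (p - 1)) ^ 2 = 1 ^ 2] (mod int p)"
        by (intro cong_pow franel_prime_pred assms) (simp add: p)
      ultimately have "[coeff ?y (4 * n) = 1 - 1 ^ 2] (mod int p)"
        unfolding coeff_diff by (metis cong_diff)
      thus ?thesis unfolding e by (simp add: cong_0_iff)
    qed
  qed
  thus ?thesis by (simp add: pcong_def)
qed

lemma fermat_int:
  assumes "prime p" "\<not> int p dvd a"
  shows "[a ^ (p - 1) = 1] (mod int p)"
proof -
  have a: "[int (nat (a mod int p)) = a] (mod int p)" using assms prime_gt_0_nat[of p] by simp
  hence "\<not> p dvd nat (a mod int p)" using assms(2) cong_dvd_iff by (metis of_nat_dvd_iff)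
  hence "[nat (a mod int p) ^ (p - 1) = 1] (mod p)" using assms(1) by (rule fermat_theorem[rotated])
  hence "[int (nat (a mod int p)) ^ (p - 1) = 1] (mod int p)"
    by (metis cong_int_iff of_nat_1 of_nat_power)
  thus ?thesis using cong_trans[OF cong_pow[OF cong_sym[OF a]]] by blast
qed

text \<open>
  The factor \<open>8z\<^sup>2 + 4z - 1\<close> divides \<open>Q\<^sup>2 + 16 P\<close>, so the Clausen argument \<open>P / Q\<^sup>2\<close>
  equals \<open>-1/16\<close> here. Multiplication by \<open>(-16)^(p-1)\<close> clears the denominators, and the terms with \<open>k > n\<close>
  vanish because \<open>p\<close> divides \<open>2k choose k\<close>.
\<close>
lemma franel_sum_square:
  assumes "prime p" and p: "p = 2 * n + 1" and p3: "p > 3" and z: "[8 * z^2 + 4 * z = 1] (mod int p)"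
  shows "[(\<Sum>k<p. int (central_franel k) * (-16) ^ (p - 1 - k)) = (poly (franel_poly p) z)^2] (mod int p)"
proof -
  define P Q where "P = poly ode_P z" and "Q = poly ode_Q z"
  have pi: "prime (int p)" using assms(1) by simp
  have zd: "int p dvd 8 * z^2 + 4 * z - 1" using z by (simp add: cong_iff_dvd_diff)
  have "Q^2 + 16 * P = (8 * z^2 + 4 * z - 1) * (8 * z^2 - 20 * z - 1)"
    by (simp add: P_def Q_def ode_P_def ode_Q_def power2_eq_square algebra_simps)
  hence "int p dvd Q^2 + 16 * P" using zd by simp
  hence Q2: "[Q^2 = -16 * P] (mod int p)" by (simp add: cong_iff_dvd_diff)
  have nQ: "\<not> int p dvd Q"
  proof
    assume "int p dvd Q"
    hence "int p dvd 2 * (8 * z^2 + 4 * z - 1) - (4 * z + 4) * (8 * z^2 + 4 * z - 1 - Q)"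
      using zd by (simp only: dvd_diff dvd_mult)
    \<comment> \<open>The resultant of \<open>8z\<^sup>2 + 4z - 1\<close> and \<open>Q\<close> has only the prime factors \<open>2\<close> and \<open>3\<close>.\<close>
    also have "2 * (8 * z^2 + 4 * z - 1) - (4 * z + 4) * (8 * z^2 + 4 * z - 1 - Q) = 6"
      by (simp add: Q_def ode_Q_def power2_eq_square algebra_simps)
    finally have "int p dvd int 6" by simp
    hence "p dvd 2 * 3" by (simp only: of_nat_dvd_iff) simp
    hence "p dvd 2 \<or> p dvd 3" using assms(1) by (simp only: prime_dvd_mult_iff)
    thus False using p3 by (auto dest: dvd_imp_le)
  qed
  have n16: "\<not> int p dvd -16"
  proof
    assume "int p dvd -16"
    hence "int p dvd 2 ^ 4" by simp
    hence "int p dvd 2" by (rule prime_dvd_power[OF pi])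
    thus False using p3 by (auto dest: zdvd_imp_le)
  qed
  have Pn: "[P ^ n = (-16) ^ n] (mod int p)"
  proof -
    have "[(-16) ^ n * P ^ n = 1] (mod int p)"
    proof -
      have "[(-16) ^ n * P ^ n = (Q ^ 2) ^ n] (mod int p)"
        unfolding power_mult_distrib[symmetric] by (intro cong_pow cong_sym[OF Q2])
      also have "(Q ^ 2) ^ n = Q ^ (p - 1)" by (simp add: p power_mult)
      also have "[Q ^ (p - 1) = 1] (mod int p)" by (rule fermat_int[OF assms(1) nQ])
      finally show ?thesis .
    qed
    hence "[(-16) ^ n * ((-16) ^ n * P ^ n) = (-16) ^ n * 1] (mod int p)" by (rule cong_scalar_left)
    moreover have "(-16) ^ n * ((-16) ^ n * P ^ n) = (-16) ^ (p - 1) * P ^ n"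
      by (simp add: p mult_2 power_add)
    moreover have "[(-16) ^ (p - 1) * P ^ n = 1 * P ^ n] (mod int p)"
      by (rule cong_scalar_right[OF fermat_int[OF assms(1) n16]])
    ultimately show ?thesis by (metis cong_sym cong_trans mult_1 mult.right_neutral)
  qed
  have "[poly (franel_poly p * franel_poly p) z = poly (clausen_sum n) z] (mod int p)"
    by (rule cong_sym[OF pcong_poly[OF clausen_franel[OF assms(1) p]]])
  also have "poly (clausen_sum n) z = (\<Sum>k\<le>n. int (central_franel k) * (P ^ k * (Q ^ 2) ^ (n - k)))"
    by (simp add: clausen_sum_def poly_sum P_def Q_def power_mult)
  also have "[\<dots> = (\<Sum>k\<le>n. int (central_franel k) * (-16) ^ (p - 1 - k))] (mod int p)"
  proof (intro cong_sum cong_scalar_left)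
    fix k assume "k \<in> {..n}"
    then obtain m where m: "n = k + m" using le_Suc_ex by auto
    have "[P ^ k * (Q ^ 2) ^ (n - k) = P ^ k * (-16 * P) ^ (n - k)] (mod int p)"
      by (intro cong_scalar_left cong_pow Q2)
    also have "P ^ k * (-16 * P) ^ (n - k) = (-16) ^ m * P ^ n"
      unfolding power_mult_distrib by (simp add: m power_add)
    also have "[(-16) ^ m * P ^ n = (-16) ^ m * (-16) ^ n] (mod int p)"
      by (intro cong_scalar_left Pn)
    also have "(-16) ^ m * (-16) ^ n = ((-16)::int) ^ (p - 1 - k)"
      unfolding power_add[symmetric] by (rule arg_cong) (simp add: p m)
    finally show "[P ^ k * (Q ^ 2) ^ (n - k) = (-16) ^ (p - 1 - k)] (mod int p)" .
  qed
  also have "[(\<Sum>k\<le>n. int (central_franel k) * (-16) ^ (p - 1 - k))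
      = (\<Sum>k\<le>n. int (central_franel k) * (-16) ^ (p - 1
      - k)) + (\<Sum>k\<in>{n<..<p}. int (central_franel k) * (-16) ^ (p - 1 - k))] (mod int p)"
  proof -
    have "int p dvd (\<Sum>k\<in>{n<..<p}. int (central_franel k) * (-16) ^ (p - 1 - k))"
    proof (intro dvd_sum dvd_mult2)
      fix k assume k: "k \<in> {n<..<p}"
      have "p dvd fact (2 * k)" using k p assms(1) by (simp add: prime_dvd_fact_iff)
      also have "fact (2 * k) = fact k * fact k * ((2 * k) choose k)"
        using binomial_fact_lemma[of k "2 * k"] by simp
      finally have "p dvd (2 * k) choose k" using assms(1) k
        by (simp add: prime_dvd_mult_iff prime_dvd_fact_iff)
      thus "int p dvd int (central_franel k)" by (simp add: central_franel_def)
    qed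
    thus ?thesis by (simp add: cong_iff_dvd_diff)
  qed
  also have "(\<Sum>k\<le>n. int (central_franel k) * (-16) ^ (p - 1
      - k)) + (\<Sum>k\<in>{n<..<p}. int (central_franel k) * (-16) ^ (p - 1 - k))
      = (\<Sum>k<p. int (central_franel k) * (-16) ^ (p - 1 - k))"
  proof -
    have "{..<p} = {..n} \<union> {n<..<p}" using p by auto
    thus ?thesis by (simp add: sum.union_disjoint ivl_disj_int)
  qed
  finally show ?thesis by (simp add: power2_eq_square cong_sym)
qed

section \<open>Quadratic character sums\<close>

text \<open>
  Residues are represented by the integers in \<open>R\<close>, nonzero ones by \<open>R1\<close>. Substitutions in sums over \<open>R\<close>
  are legitimate for summands that depend on the residue class only.
\<close>
locale odd_prime =
  fixes p :: nat
  assumes prime_p: "prime p" and p_gt_2: "p > 2"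
begin

abbreviation R :: "int set" where "R \<equiv> {0..<int p}"
abbreviation R1 :: "int set" where "R1 \<equiv> {1..<int p}"
definition \<phi> :: "int \<Rightarrow> int" where "\<phi> a = Legendre a (int p)"
definition periodic :: "(int \<Rightarrow> 'a) \<Rightarrow> bool" where
  "periodic f \<longleftrightarrow> (\<forall>x y. [x = y] (mod int p) \<longrightarrow> f x = f y)"

lemma prime_int_p: "prime (int p)" using prime_p by simp
lemma p_pos: "int p > 0" using p_gt_2 by simp
lemma p_dvd_mult: "int p dvd a * b \<longleftrightarrow> int p dvd a \<or> int p dvd b"
  using prime_int_p by (rule prime_dvd_mult_iff)
lemma p_dvd_power: "int p dvd a ^ n \<Longrightarrow> int p dvd a"
  using prime_int_p by (rule prime_dvd_power)
lemma p_not_dvd_2: "\<not> int p dvd 2" using p_gt_2 by (auto dest: zdvd_imp_le)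
lemma p_not_dvd_4: "\<not> int p dvd 4" using p_dvd_mult[of 2 2] p_not_dvd_2 by simp
lemma dvd_R: "x \<in> R \<Longrightarrow> int p dvd x \<longleftrightarrow> x = 0" by (auto dest: zdvd_imp_le)
lemma dvd_R1: "x \<in> R1 \<Longrightarrow> \<not> int p dvd x" by (auto dest: zdvd_imp_le)
lemma R_eq: "R = insert 0 R1" using p_gt_2 by auto
lemma sum_R: "sum f R = f 0 + sum f R1" unfolding R_eq by simp

lemma \<phi>_cong: "[a = b] (mod int p) \<Longrightarrow> \<phi> a = \<phi> b"
proof -
  assume ab: "[a = b] (mod int p)"
  have "[x = a] (mod int p) \<longleftrightarrow> [x = b] (mod int p)" for x
    using cong_trans[OF _ ab] cong_trans[OF _ cong_sym[OF ab]] by blast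
  moreover from this[of 0] have "[a = 0] (mod int p) \<longleftrightarrow> [b = 0] (mod int p)"
    by (simp add: cong_sym_eq)
  ultimately show ?thesis unfolding \<phi>_def Legendre_def QuadRes_def by simp
qed

lemma euler: "[\<phi> a = a ^ ((p - 1) div 2)] (mod int p)"
  unfolding \<phi>_def using euler_criterion[OF prime_p, of a] p_gt_2 by simp

lemma \<phi>_eq_0: "\<phi> a = 0 \<longleftrightarrow> int p dvd a"
  by (auto simp: \<phi>_def Legendre_def cong_0_iff)
lemma \<phi>_0 [simp]: "\<phi> 0 = 0" by (simp add: \<phi>_eq_0)

lemma \<phi>_range: "\<phi> a \<in> {-1, 0, 1}"
  by (auto simp: \<phi>_def Legendre_def)

lemma \<phi>_eqI: assumes "[\<phi> a = s] (mod int p)" "s \<in> {-1, 0, 1}" shows "\<phi> a = s"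
proof -
  have "int p dvd \<phi> a - s" using assms(1) by (simp add: cong_iff_dvd_diff)
  moreover have "\<bar>\<phi> a - s\<bar> < int p" using \<phi>_range[of a] assms(2) p_gt_2 by auto
  ultimately show ?thesis using zdvd_imp_le[of "int p" "\<bar>\<phi> a - s\<bar>"]
      by (cases "\<phi> a = s") auto
qed

lemma \<phi>_mult: "\<phi> (a * b) = \<phi> a * \<phi> b"
proof (rule \<phi>_eqI)
  have "[\<phi> (a * b) = a ^ ((p - 1) div 2) * b ^ ((p - 1) div 2)] (mod int p)"
    using euler[of "a * b"] by (simp add: power_mult_distrib)
  thus "[\<phi> (a * b) = \<phi> a * \<phi> b] (mod int p)"
    by (rule cong_trans[OF _ cong_sym[OF cong_mult[OF euler euler]]])
  show "\<phi> a * \<phi> b \<in> {-1, 0, 1}" using \<phi>_range[of a] \<phi>_range[of b] by auto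
qed

lemma \<phi>_sq: "\<not> int p dvd a \<Longrightarrow> \<phi> a * \<phi> a = 1"
  using \<phi>_range[of a] \<phi>_eq_0[of a] by auto
lemma \<phi>_square: "\<not> int p dvd a \<Longrightarrow> \<phi> (a ^ 2) = 1"
  by (simp add: power2_eq_square \<phi>_mult \<phi>_sq)
lemma \<phi>_1 [simp]: "\<phi> 1 = 1" using \<phi>_square[of 1] p_gt_2 by simp
lemma \<phi>_square_mult: "\<not> int p dvd a \<Longrightarrow> \<phi> (a ^ 2 * b) = \<phi> b"
  by (simp add: \<phi>_square \<phi>_mult)

lemma periodic_\<phi>: "(\<And>x y. [x = y] (mod int p)
    \<Longrightarrow> [g x = g y] (mod int p)) \<Longrightarrow> periodic (\<lambda>x. \<phi> (g x))"
  unfolding periodic_def by (intro allI impI \<phi>_cong)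

lemma affine_bij:
  assumes "\<not> int p dvd a"
  shows "bij_betw (\<lambda>x. (a * x + c) mod int p) R R"
proof -
  have inj: "inj_on (\<lambda>x. (a * x + c) mod int p) R"
  proof (rule inj_onI)
    fix x y assume xy: "x \<in> R" "y \<in> R" "(a * x + c) mod int p = (a * y + c) mod int p"
    hence "int p dvd (a * x + c) - (a * y + c)" by (simp add: mod_eq_dvd_iff)
    also have "(a * x + c) - (a * y + c) = a * (x - y)" by (simp add: algebra_simps)
    finally have "int p dvd x - y" using assms by (simp add: p_dvd_mult)
    hence "x mod int p = y mod int p" by (simp add: mod_eq_dvd_iff)
    thus "x = y" using xy by simp
  qed
  moreover have "(\<lambda>x. (a * x + c) mod int p) ` R = R"
    by (rule endo_inj_surj[OF _ _ inj]) (use p_pos in auto)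
  ultimately show ?thesis by (simp add: bij_betw_def)
qed

lemma sum_affine:
  assumes "\<not> int p dvd a" "periodic f"
  shows "(\<Sum>x\<in>R. f (a * x + c)) = (\<Sum>x\<in>R. f x)"
proof -
  have "(\<Sum>x\<in>R. f (a * x + c)) = (\<Sum>x\<in>R. f ((a * x + c) mod int p))"
  proof (rule sum.cong[OF refl])
    fix x
    have "[a * x + c = (a * x + c) mod int p] (mod int p)" by (simp add: cong_sym)
    thus "f (a * x + c) = f ((a * x + c) mod int p)" using assms(2) unfolding periodic_def by blast
  qed
  also have "\<dots> = (\<Sum>x\<in>R. f x)" by (rule sum.reindex_bij_betw[OF affine_bij[OF assms(1)]])
  finally show ?thesis .
qed

lemma periodic_dvd: "(\<And>x y. [x = y] (mod int p) \<Longrightarrow> [g x = g y] (mod int p)) 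
    \<Longrightarrow> periodic (\<lambda>x. of_bool (int p dvd g x) :: int)"
proof -
  assume g: "\<And>x y. [x = y] (mod int p) \<Longrightarrow> [g x = g y] (mod int p)"
  show ?thesis unfolding periodic_def
  proof (intro allI impI)
    fix x y assume "[x = y] (mod int p)"
    thus "of_bool (int p dvd g x) = (of_bool (int p dvd g y) :: int)"
      by (simp only: cong_dvd_iff[OF g])
  qed
qed

lemma count_linear:
  assumes "\<not> int p dvd a"
  shows "(\<Sum>x\<in>R. of_bool (int p dvd a * x + c)) = (1::int)"
proof -
  have "(\<Sum>x\<in>R. of_bool (int p dvd a * x + c)) = (\<Sum>x\<in>R. of_bool (int p dvd x) :: int)"
    by (rule sum_affine[OF assms, of "\<lambda>x. of_bool (int p dvd x)"]) (rule periodic_dvd)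
  also have "\<dots> = (\<Sum>x\<in>R. if x = 0 then 1 else 0)"
    by (intro sum.cong refl) (simp add: dvd_R del: atLeastLessThan_iff)
  also have "\<dots> = 1" using p_pos by simp
  finally show ?thesis .
qed

lemma count_sqrt: "(\<Sum>x\<in>R. of_bool (int p dvd x ^ 2 - d)) = 1 + \<phi> d"
proof (cases "QuadRes (int p) d")
  case True
  then obtain s where s: "[s ^ 2 = d] (mod int p)" unfolding QuadRes_def by blast
  have "int p dvd x ^ 2 - d \<longleftrightarrow> int p dvd (x - s) \<or> int p dvd (x + s)" for x
  proof -
    have "int p dvd x ^ 2 - d \<longleftrightarrow> int p dvd x ^ 2 - s ^ 2"
      by (rule cong_dvd_iff[OF cong_diff[OF cong_refl cong_sym[OF s]]])
    also have "x ^ 2 - s ^ 2 = (x - s) * (x + s)" by (simp add: power2_eq_square algebra_simps)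
    finally show ?thesis by (simp add: p_dvd_mult)
  qed
  hence "(\<Sum>x\<in>R. of_bool (int p dvd x ^ 2 - d))
      = (\<Sum>x\<in>R. of_bool (int p dvd 1 * x + (- s)) + of_bool (int p dvd 1 * x + s)
       - of_bool (int p dvd x - s \<and> int p dvd x + s) :: int)"
    by (intro sum.cong refl) (simp add: of_bool_def)
  also have "\<dots> = 1 + 1 - (\<Sum>x\<in>R. of_bool (int p dvd x - s \<and> int p dvd x + s))"
  proof -
    have "\<not> int p dvd 1" using p_gt_2 by simp
    from count_linear[OF this, of s] count_linear[OF this, of "- s"] show ?thesis
      by (simp only: sum_subtractf sum.distrib)
  qed
  also have "(\<Sum>x\<in>R. of_bool (int p dvd x - s \<and> int p dvd x + s) :: int) = 1 - \<phi> d"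
  proof (cases "int p dvd d")
    case True
    hence "int p dvd s ^ 2" using cong_dvd_iff[OF s] by blast
    hence "int p dvd s" by (rule p_dvd_power)
    hence "int p dvd x + s \<longleftrightarrow> int p dvd x" "int p dvd x - s
        \<longleftrightarrow> int p dvd x" for x
      by (rule dvd_add_left_iff dvd_diff_left_iff; assumption)+
    hence eq: "(int p dvd x - s \<and> int p dvd x + s) \<longleftrightarrow> int p dvd 1 * x + 0" for x
      by simp
    have "(\<Sum>x\<in>R. of_bool (int p dvd x - s \<and> int p dvd x + s) :: int)
        = (\<Sum>x\<in>R. of_bool (int p dvd 1 * x + 0))"
      by (simp only: eq)
    also have "\<dots> = 1" using p_gt_2 by (intro count_linear) auto
    finally show ?thesis using True \<phi>_eq_0 by simp
  next
    case False
    hence "\<not> int p dvd s ^ 2" using cong_dvd_iff[OF s] by blast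
    hence "\<not> int p dvd s" by (auto simp: power2_eq_square)
    have "\<not> (int p dvd x - s \<and> int p dvd x + s)" for x
    proof
      assume "int p dvd x - s \<and> int p dvd x + s"
      hence "int p dvd (x + s) - (x - s)" by (elim conjE) (rule dvd_diff)
      hence "int p dvd 2 * s" by simp
      thus False using p_not_dvd_2 \<open>\<not> int p dvd s\<close> p_dvd_mult by blast
    qed
    hence "(\<Sum>x\<in>R. of_bool (int p dvd x - s \<and> int p dvd x + s) :: int) = 0"
      by (intro sum.neutral) simp
    moreover have "\<phi> d = 1" using \<open>QuadRes (int p) d\<close> False
        by (simp add: \<phi>_def Legendre_def cong_0_iff)
    ultimately show ?thesis by simp
  qed
  finally show ?thesis by simp
next
  case False
  have "\<not> int p dvd d" 
  proof
    assume "int p dvd d"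
    hence "[0 ^ 2 = d] (mod int p)" by (simp add: cong_sym cong_0_iff)
    thus False using False unfolding QuadRes_def by blast
  qed
  hence "\<phi> d = -1" using False by (simp add: \<phi>_def Legendre_def cong_0_iff)
  moreover have "\<not> int p dvd x ^ 2 - d" for x
    using False unfolding QuadRes_def by (auto simp: cong_iff_dvd_diff)
  ultimately show ?thesis by simp
qed

lemma count_quadratic:
  assumes "\<not> int p dvd a"
  shows "(\<Sum>x\<in>R. of_bool (int p dvd a * x ^ 2 + b * x + c)) = 1 + \<phi> (b ^ 2 - 4 * a * c)"
proof -
  have n: "\<not> int p dvd 2 * a" "\<not> int p dvd 4
      * a" using assms p_not_dvd_2 p_not_dvd_4 p_dvd_mult by auto
  have "int p dvd a * x ^ 2 + b * x + c \<longleftrightarrow> int p dvd (2 * a * x + b) ^ 2 - (b ^ 2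
      - 4 * a * c)" for x
  proof -
    have "(2 * a * x + b) ^ 2 - (b ^ 2 - 4 * a * c) = (4 * a) * (a * x ^ 2 + b * x + c)"
      by (simp add: power2_eq_square algebra_simps)
    thus ?thesis using n by (simp add: p_dvd_mult)
  qed
  hence "(\<Sum>x\<in>R. of_bool (int p dvd a * x ^ 2 + b * x + c) :: int)
       = (\<Sum>x\<in>R. of_bool (int p dvd (2 * a * x + b) ^ 2 - (b ^ 2 - 4 * a * c)))" by (simp only:)
  also have "\<dots> = (\<Sum>x\<in>R. of_bool (int p dvd x ^ 2 - (b ^ 2 - 4 * a * c)))"
    by (rule sum_affine[OF n(1), of "\<lambda>x. of_bool (int p dvd x ^ 2 - (b ^ 2 - 4 * a * c))"])
       (intro periodic_dvd cong_diff cong_pow cong_refl)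
  finally show ?thesis unfolding count_sqrt .
qed

text \<open>
  The sum counts the points of the hyperbola \<open>s\<^sup>2 = x\<^sup>2 - d\<close>. Replacing \<open>x\<close> by \<open>x + s\<close> makes the equation
  linear in \<open>s\<close>, and every nonzero \<open>x\<close> then carries exactly one point.
\<close>
lemma sum_\<phi>_shifted_square:
  assumes "\<not> int p dvd d"
  shows "(\<Sum>x\<in>R. \<phi> (x ^ 2 - d)) = -1"
proof -
  have "(\<Sum>x\<in>R. 1 + \<phi> (x ^ 2 - d)) = (\<Sum>x\<in>R. \<Sum>s\<in>R. of_bool
      (int p dvd s ^ 2 - (x ^ 2 - d)) :: int)"
    by (simp add: count_sqrt)
  also have "\<dots> = (\<Sum>s\<in>R. \<Sum>x\<in>R. of_bool (int p dvd s ^ 2 - (x ^ 2 - d)))"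
      by (rule sum.swap)
  also have "\<dots> = (\<Sum>s\<in>R. \<Sum>x\<in>R. of_bool (int p dvd (2 * x) * s + (x ^ 2 - d)))"
  proof (rule sum.cong[OF refl])
    fix s
    have "(\<Sum>x\<in>R. of_bool (int p dvd s ^ 2 - (x ^ 2 - d)) :: int) = 
        (\<Sum>x\<in>R. of_bool (int p dvd s ^ 2 - ((1 * x + s) ^ 2 - d)))"
      using p_gt_2 by (intro sum_affine[symmetric, of 1 "\<lambda>x. of_bool (int p dvd s ^ 2 - (x ^ 2
          - d))"] periodic_dvd cong_diff cong_pow cong_refl) auto
    also have "\<dots> = (\<Sum>x\<in>R. of_bool (int p dvd (2 * x) * s + (x ^ 2 - d)))"
    proof (rule sum.cong[OF refl])
      fix x
      have "s ^ 2 - ((1 * x + s) ^ 2 - d) = - ((2 * x) * s + (x ^ 2 - d))"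
        by (simp add: power2_eq_square algebra_simps)
      thus "(of_bool (int p dvd s ^ 2 - ((1 * x + s) ^ 2 - d)) :: int)
          = of_bool (int p dvd (2 * x) * s + (x ^ 2 - d))"
        by (simp only: dvd_minus_iff)
    qed
    finally show "(\<Sum>x\<in>R. of_bool (int p dvd s ^ 2 - (x ^ 2 - d)) :: int) = 
        (\<Sum>x\<in>R. of_bool (int p dvd (2 * x) * s + (x ^ 2 - d)))" .
  qed
  also have "\<dots> = (\<Sum>x\<in>R. \<Sum>s\<in>R. of_bool (int p dvd (2 * x) * s + (x ^ 2 - d)))"
      by (rule sum.swap)
  also have "\<dots> = (\<Sum>x\<in>R. if x = 0 then 0 else 1)"
  proof (rule sum.cong[OF refl])
    fix x assume x: "x \<in> R"
    show "(\<Sum>s\<in>R. of_bool (int p dvd (2 * x) * s + (x ^ 2 - d)) :: int) = (if x = 0 then 0 else 1)"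
    proof (cases "x = 0")
      case True thus ?thesis using assms by simp
    next
      case False
      hence "\<not> int p dvd 2 * x" using x dvd_R p_not_dvd_2 p_dvd_mult by auto
      thus ?thesis using False count_linear by auto
    qed
  qed
  also have "\<dots> = int p - 1"
  proof -
    have "(\<Sum>x\<in>R1. if x = 0 then 0 else (1::int)) = (\<Sum>x\<in>R1. 1)" by (intro sum.cong) auto
    thus ?thesis unfolding sum_R using p_gt_2 by simp
  qed
  finally show ?thesis by (simp add: sum.distrib)
qed

lemma sum_\<phi>_quadratic:
  assumes "\<not> int p dvd a" "\<not> int p dvd b ^ 2 - 4 * a * c"
  shows "(\<Sum>x\<in>R. \<phi> (a * x ^ 2 + b * x + c)) = - \<phi> a"
proof -
  have n: "\<not> int p dvd 2 * a" using assms p_not_dvd_2 p_dvd_mult by auto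
  have "\<phi> (a * x ^ 2 + b * x + c) = \<phi> a * \<phi> ((2 * a * x + b) ^ 2 - (b ^ 2 - 4 * a * c))" for x
  proof -
    have "(2 * a * x + b) ^ 2 - (b ^ 2 - 4 * a * c) = 2 ^ 2 * (a * (a * x ^ 2 + b * x + c))"
      by (simp add: power2_eq_square algebra_simps)
    hence "\<phi> ((2 * a * x + b) ^ 2 - (b ^ 2 - 4 * a * c)) = \<phi> a * \<phi> (a * x ^ 2 + b * x + c)"
      using \<phi>_square_mult[OF p_not_dvd_2] by (simp add: \<phi>_mult)
    hence "\<phi> a * \<phi> ((2 * a * x + b) ^ 2 - (b ^ 2 - 4 * a * c))
        = (\<phi> a * \<phi> a) * \<phi> (a * x ^ 2 + b * x + c)"
      by (simp only: mult.assoc)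
    thus ?thesis using \<phi>_sq[OF assms(1)] by simp
  qed
  hence "(\<Sum>x\<in>R. \<phi> (a * x ^ 2 + b * x + c))
      = \<phi> a * (\<Sum>x\<in>R. \<phi> ((2 * a * x + b) ^ 2 - (b ^ 2 - 4 * a * c)))"
    unfolding sum_distrib_left by (rule sum.cong[OF refl])
  also have "(\<Sum>x\<in>R. \<phi> ((2 * a * x + b) ^ 2 - (b ^ 2 - 4 * a * c)))
      = (\<Sum>x\<in>R. \<phi> (x ^ 2 - (b ^ 2 - 4 * a * c)))"
    by (rule sum_affine[OF n, of "\<lambda>x. \<phi> (x ^ 2 - (b ^ 2
        - 4 * a * c))"]) (intro periodic_\<phi> cong_diff cong_pow cong_refl)
  finally show ?thesis using sum_\<phi>_shifted_square[OF assms(2)] by simp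
qed

lemma sum_\<phi>: 
  assumes "\<not> int p dvd a" shows "(\<Sum>x\<in>R. \<phi> (a * x + c)) = 0"
proof -
  have "(\<Sum>x\<in>R. \<phi> (a * x + c)) = (\<Sum>x\<in>R. \<phi> x)"
    by (rule sum_affine[OF assms]) (intro periodic_\<phi>[of "\<lambda>x. x"])
  also have "\<dots> = 0"
  proof -
    have "(\<Sum>d\<in>R. 1 + \<phi> d) = (\<Sum>d\<in>R. \<Sum>x\<in>R. of_bool (int p dvd (-1) * d
        + x ^ 2) :: int)"
    proof (rule sum.cong[OF refl])
      fix d
      have "(-1) * d + x ^ 2 = x ^ 2 - d" for x :: int by simp
      thus "1 + \<phi> d = (\<Sum>x\<in>R. of_bool (int p dvd (-1) * d + x ^ 2) :: int)"
        by (simp only: count_sqrt)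
    qed
    also have "\<dots> = (\<Sum>x\<in>R. \<Sum>d\<in>R. of_bool (int p dvd (-1) * d + x ^ 2))"
        by (rule sum.swap)
    also have "\<dots> = (\<Sum>x\<in>R. 1)" using p_gt_2 by (intro sum.cong refl count_linear) auto
    finally show ?thesis by (simp add: sum.distrib)
  qed
  finally show ?thesis .
qed

end

context odd_prime begin

section \<open>Jacobsthal sums\<close>

definition cubic_sum :: "int \<Rightarrow> int" where "cubic_sum c = (\<Sum>x\<in>R. \<phi> (x * (x ^ 2 + c)))"

lemma periodic_cubic_sum_term: "periodic (\<lambda>x. \<phi> (x * (x ^ 2 + c)))"
  by (intro periodic_\<phi> cong_mult cong_add cong_pow cong_refl)

lemma cubic_sum_cong: "[c = d] (mod int p) \<Longrightarrow> cubic_sum c = cubic_sum d"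
  unfolding cubic_sum_def by (intro sum.cong refl \<phi>_cong cong_mult cong_add cong_refl)

lemma cubic_sum_0: "cubic_sum 0 = 0"
proof -
  have "\<phi> (x * (x ^ 2 + 0)) = \<phi> (1 * x + 0)" for x
  proof (cases "int p dvd x")
    case True
    hence "\<phi> x = 0" by (simp only: \<phi>_eq_0)
    thus ?thesis by (simp add: \<phi>_mult)
  next
    case False
    thus ?thesis using \<phi>_square_mult[OF False, of x] by (simp add: mult.commute)
  qed
  hence "cubic_sum 0 = (\<Sum>x\<in>R. \<phi> (1 * x + 0))" by (simp only: cubic_sum_def)
  also have "\<dots> = 0" by (rule sum_\<phi>) (use p_gt_2 in simp)
  finally show ?thesis .
qed

lemma cubic_sum_square_twist:
  assumes "\<not> int p dvd k" shows "cubic_sum (c * k ^ 2) = \<phi> k * cubic_sum c"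
proof -
  have "cubic_sum (c * k ^ 2) = (\<Sum>x\<in>R. \<phi> ((k * x + 0) * ((k * x + 0) ^ 2 + c * k ^ 2)))"
    unfolding cubic_sum_def by (rule sum_affine[OF assms periodic_cubic_sum_term, symmetric])
  also have "\<dots> = (\<Sum>x\<in>R. \<phi> k * \<phi> (x * (x ^ 2 + c)))"
  proof (rule sum.cong[OF refl])
    fix x
    have "(k * x + 0) * ((k * x + 0) ^ 2 + c * k ^ 2) = k ^ 2 * (k * (x * (x ^ 2 + c)))"
      by (simp add: power2_eq_square algebra_simps)
    thus "\<phi> ((k * x + 0) * ((k * x + 0) ^ 2 + c * k ^ 2)) = \<phi> k * \<phi> (x * (x ^ 2 + c))"
      by (simp only: \<phi>_square_mult[OF assms] \<phi>_mult[of k])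
  qed
  finally show ?thesis by (simp only: cubic_sum_def sum_distrib_left)
qed

lemma sum_delta_mod:
  fixes f :: "int \<Rightarrow> int"
  assumes "periodic f"
  shows "(\<Sum>y\<in>R. f y * of_bool (int p dvd y - a)) = f a"
proof -
  have "(\<Sum>y\<in>R. f y * of_bool (int p dvd y - a))
      = (\<Sum>y\<in>R. f a * of_bool (int p dvd 1 * y + (- a)))"
  proof (rule sum.cong[OF refl])
    fix y
    have "f y = f a" if "int p dvd y - a"
      using assms that unfolding periodic_def cong_iff_dvd_diff by blast
    thus "f y * of_bool (int p dvd y - a) = f a * of_bool (int p dvd 1 * y + (- a))" by auto
  qed
  also have "\<dots> = f a * 1"
    unfolding sum_distrib_left[symmetric] using p_gt_2 by (subst count_linear) auto
  finally show ?thesis by simp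
qed

text \<open>Every \<open>c\<close> is hit \<open>1 + \<phi> (b * c)\<close> times
    by \<open>b * k\<^sup>2\<close>.\<close>
lemma sum_along_squares:
  fixes f :: "int \<Rightarrow> int"
  assumes "periodic f" "\<not> int p dvd b"
  shows "(\<Sum>k\<in>R. f (b * k ^ 2)) = (\<Sum>c\<in>R. f c * (1 + \<phi> (b * c)))"
proof -
  have "(\<Sum>k\<in>R. f (b * k ^ 2)) = (\<Sum>k\<in>R. \<Sum>c\<in>R. f c * of_bool (int p dvd c
      - b * k ^ 2))"
    by (simp only: sum_delta_mod[OF assms(1)])
  also have "\<dots> = (\<Sum>c\<in>R. \<Sum>k\<in>R. f c * of_bool (int p dvd c - b * k ^ 2))"
      by (rule sum.swap)
  also have "\<dots> = (\<Sum>c\<in>R. f c * (1 + \<phi> (b * c)))"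
  proof (rule sum.cong[OF refl])
    fix c
    have "(\<Sum>k\<in>R. f c * of_bool (int p dvd c - b * k ^ 2))
        = f c * (\<Sum>k\<in>R. of_bool (int p dvd b * k ^ 2 + 0 * k + (- c)))"
    proof -
      have "int p dvd c - b * k ^ 2 \<longleftrightarrow> int p dvd b * k ^ 2 + 0 * k + (- c)" for k
        by (simp add: dvd_diff_commute)
      thus ?thesis by (simp only: sum_distrib_left)
    qed
    also have "\<dots> = f c * (1 + \<phi> (0 ^ 2 - 4 * b * (- c)))"
        by (simp only: count_quadratic[OF assms(2)])
    also have "0 ^ 2 - 4 * b * (- c) = 2 ^ 2 * (b * c)" by simp
    finally show "(\<Sum>k\<in>R. f c * of_bool (int p dvd c - b * k ^ 2)) = f c * (1 + \<phi> (b * c))"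
      by (simp only: \<phi>_square_mult[OF p_not_dvd_2])
  qed
  finally show ?thesis .
qed

lemma sum_\<phi>_UNIV: "(\<Sum>x\<in>R. \<phi> x) = 0"
  using sum_\<phi>[of 1 0] p_gt_2 by simp

lemma nonresidue_exists: "\<exists>g. \<phi> g = -1"
proof (rule ccontr)
  assume "\<nexists>g. \<phi> g = -1"
  hence "\<phi> x \<ge> 0" for x using \<phi>_range[of x] by auto
  hence "(\<Sum>x\<in>{1}. \<phi> x) \<le> (\<Sum>x\<in>R. \<phi> x)" using p_gt_2 by (intro sum_mono2) auto
  thus False by (simp add: sum_\<phi>_UNIV)
qed

end

locale prime_1_mod_4 = odd_prime +
  assumes p_mod_4: "p mod 4 = 1"
begin

lemma \<phi>_minus [simp]: "\<phi> (- a) = \<phi> a"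
proof -
  have "even ((p - 1) div 2)" using p_mod_4 by presburger
  hence "[\<phi> (- 1) = 1] (mod int p)" using euler[of "- 1"] by simp
  hence "\<phi> (- 1) = 1" by (rule \<phi>_eqI) simp
  thus ?thesis using \<phi>_mult[of "- 1" a] by simp
qed

lemma sum_\<phi>_product:
  "(\<Sum>c\<in>R. \<phi> ((x ^ 2 + c) * (y ^ 2 + c))) = int p * of_bool (int p dvd y ^ 2 - x ^ 2) - 1"
proof (cases "int p dvd y ^ 2 - x ^ 2")
  case False
  have d: "\<not> int p dvd (x ^ 2 + y ^ 2) ^ 2 - 4 * 1 * (x ^ 2 * y ^ 2)"
  proof
    assume "int p dvd (x ^ 2 + y ^ 2) ^ 2 - 4 * 1 * (x ^ 2 * y ^ 2)"
    also have "(x ^ 2 + y ^ 2) ^ 2 - 4 * 1 * (x ^ 2 * y ^ 2) = (y ^ 2 - x ^ 2) ^ 2"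
      by (simp add: power2_eq_square algebra_simps)
    finally show False using False p_dvd_power by blast
  qed
  have "(\<Sum>c\<in>R. \<phi> ((x ^ 2 + c) * (y ^ 2 + c)))
      = (\<Sum>c\<in>R. \<phi> (1 * c ^ 2 + (x ^ 2 + y ^ 2) * c + x ^ 2 * y ^ 2))"
    by (intro sum.cong refl arg_cong[of _ _ \<phi>]) (simp add: power2_eq_square algebra_simps)
  also have "\<dots> = - \<phi> 1" by (rule sum_\<phi>_quadratic[OF _ d]) (use p_gt_2 in simp)
  finally show ?thesis using False by simp
next
  case True
  have "(\<Sum>c\<in>R. \<phi> ((x ^ 2 + c) * (y ^ 2 + c)))
      = (\<Sum>c\<in>R. 1 - of_bool (int p dvd 1 * c + x ^ 2))"
  proof (rule sum.cong[OF refl])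
    fix c
    have "[y ^ 2 + c = x ^ 2 + c] (mod int p)" using True by (simp add: cong_iff_dvd_diff)
    hence "\<phi> ((x ^ 2 + c) * (y ^ 2 + c)) = \<phi> (x ^ 2 + c) * \<phi> (x ^ 2 + c)"
      by (simp only: \<phi>_mult \<phi>_cong)
    thus "\<phi> ((x ^ 2 + c) * (y ^ 2 + c)) = 1 - of_bool (int p dvd 1 * c + x ^ 2)"
      using \<phi>_sq[of "x ^ 2 + c"] \<phi>_eq_0[of "x ^ 2 + c"] by (auto simp: add.commute)
  qed
  also have "\<dots> = int p - 1"
    unfolding sum_subtractf using p_gt_2 by (subst count_linear) auto
  finally show ?thesis using True by simp
qed

lemma sum_\<phi>_equal_squares: "\<phi> x * (\<Sum>y\<in>R. \<phi> y * of_bool (int p dvd y ^ 2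
    - x ^ 2)) = 2 * (\<phi> x * \<phi> x)"
proof (cases "int p dvd x")
  case True
  hence "\<phi> x = 0" by (simp only: \<phi>_eq_0)
  thus ?thesis by simp
next
  case False
  have "of_bool (int p dvd y ^ 2 - x ^ 2) = of_bool (int p dvd y - x) + (of_bool (int p dvd y
      - (- x)) :: int)" for y
  proof -
    have "\<not> (int p dvd y - x \<and> int p dvd y - (- x))"
    proof
      assume "int p dvd y - x \<and> int p dvd y - (- x)"
      hence "int p dvd (y - (- x)) - (y - x)" by (elim conjE) (rule dvd_diff)
      hence "int p dvd 2 * x" by simp
      thus False using p_not_dvd_2 False p_dvd_mult by blast
    qed
    moreover have "y ^ 2 - x ^ 2 = (y - x) * (y - (- x))" by (simp add: power2_eq_square algebra_simps)
    ultimately show ?thesis by (simp only: p_dvd_mult) auto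
  qed
  hence "(\<Sum>y\<in>R. \<phi> y * of_bool (int p dvd y ^ 2 - x ^ 2)) = \<phi> x + \<phi> (- x)"
    by (simp only: distrib_left sum.distrib sum_delta_mod[OF periodic_\<phi>[of "\<lambda>x. x"]])
  thus ?thesis by simp
qed

text \<open>
  Expanding the square and summing over \<open>c\<close> first leaves complete quadratic sums; only the pairs with
  \<open>y\<^sup>2 = x\<^sup>2\<close> survive.
\<close>
lemma sum_cubic_sum_square: "(\<Sum>c\<in>R. cubic_sum c ^ 2) = 2 * int p * (int p - 1)"
proof -
  have "(\<Sum>c\<in>R. cubic_sum c ^ 2) = (\<Sum>c\<in>R. \<Sum>x\<in>R. \<Sum>y\<in>R. \<phi> x
      * \<phi> y * \<phi> ((x ^ 2 + c) * (y ^ 2 + c)))"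
    unfolding cubic_sum_def power2_eq_square[of "sum _ _"] sum_product
    by (intro sum.cong refl) (simp only: \<phi>_mult mult_ac)
  also have "\<dots> = (\<Sum>x\<in>R. \<Sum>c\<in>R. \<Sum>y\<in>R. \<phi> x * \<phi> y
      * \<phi> ((x ^ 2 + c) * (y ^ 2 + c)))" by (rule sum.swap)
  also have "\<dots> = (\<Sum>x\<in>R. \<Sum>y\<in>R. \<Sum>c\<in>R. \<phi> x * \<phi> y
      * \<phi> ((x ^ 2 + c) * (y ^ 2 + c)))"
    by (rule sum.cong[OF refl sum.swap])
  also have "\<dots> = (\<Sum>x\<in>R. \<Sum>y\<in>R. \<phi> x * \<phi> y * (int p
      * of_bool (int p dvd y ^ 2 - x ^ 2) - 1))"
    by (simp only: sum_distrib_left[symmetric] sum_\<phi>_product)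
  also have "\<dots> = (\<Sum>x\<in>R. int p * (\<phi> x * (\<Sum>y\<in>R. \<phi> y
      * of_bool (int p dvd y ^ 2 - x ^ 2))) - \<phi> x * (\<Sum>y\<in>R. \<phi> y))"
    unfolding sum_distrib_left sum_subtractf[symmetric] by (simp add: algebra_simps)
  also have "\<dots> = (\<Sum>x\<in>R. 2 * int p * (\<phi> x * \<phi> x))"
    by (simp only: sum_\<phi>_equal_squares sum_\<phi>_UNIV) (simp add: algebra_simps)
  also have "\<dots> = 2 * int p * (\<Sum>x\<in>R. \<phi> x * \<phi> x)" by (simp only: sum_distrib_left)
  also have "(\<Sum>x\<in>R. \<phi> x * \<phi> x) = (\<Sum>x\<in>R1. 1)"
    unfolding sum_R by (simp add: \<phi>_sq dvd_R1 del: atLeastLessThan_iff)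
  also have "\<dots> = int p - 1" using p_gt_2 by simp
  finally show ?thesis .
qed

text \<open>
  Up to sign, \<open>cubic_sum\<close> depends on the class of its argument modulo squares only. Hence the second moment
  \<open>sum_cubic_sum_square\<close> is an average over two values, one for each class.
\<close>
lemma jacobsthal:
  assumes b: "\<not> int p dvd b" and g: "\<phi> g = -1"
  shows "cubic_sum b ^ 2 + cubic_sum (b * g) ^ 2 = 4 * int p"
proof -
  have bg: "\<not> int p dvd b * g" using b g p_dvd_mult \<phi>_eq_0[of g] by simp
  have per: "periodic (\<lambda>c. cubic_sum c ^ 2)" unfolding periodic_def using cubic_sum_cong by metis
  have sq: "(\<Sum>k\<in>R. cubic_sum (a * k ^ 2) ^ 2) = (int p - 1) * cubic_sum a ^ 2" for a
  proof -
    have "(\<Sum>k\<in>R1. cubic_sum (a * k ^ 2) ^ 2) = (\<Sum>k\<in>R1. cubic_sum a ^ 2)"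
      by (intro sum.cong refl)
         (simp add: cubic_sum_square_twist dvd_R1 power_mult_distrib power2_eq_square[of "\<phi> _"] \<phi>_sq del: atLeastLessThan_iff)
    thus ?thesis unfolding sum_R using p_gt_2 by (simp add: cubic_sum_0)
  qed
  have "(int p - 1) * (cubic_sum b ^ 2 + cubic_sum (b * g) ^ 2)
      = (\<Sum>k\<in>R. cubic_sum (b * k ^ 2) ^ 2) + (\<Sum>k\<in>R. cubic_sum (b * g * k ^ 2) ^ 2)"
    unfolding sq by (simp add: algebra_simps)
  also have "\<dots> = (\<Sum>c\<in>R. cubic_sum c ^ 2 * (1 + \<phi> (b * c)))
      + (\<Sum>c\<in>R. cubic_sum c ^ 2 * (1 + \<phi> (b * g * c)))"
    by (simp only: sum_along_squares[OF per b] sum_along_squares[OF per bg])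
  also have "\<dots> = (\<Sum>c\<in>R. 2 * cubic_sum c ^ 2)"
    unfolding sum.distrib[symmetric] by (intro sum.cong refl) (simp add: \<phi>_mult g algebra_simps)
  also have "\<dots> = 2 * (2 * int p * (int p - 1))"
    by (simp only: sum_distrib_left[symmetric] sum_cubic_sum_square)
  also have "\<dots> = (int p - 1) * (4 * int p)" by simp
  finally show ?thesis using p_gt_2 by simp
qed

lemma cubic_sum_even: "even (cubic_sum c)"
proof -
  define n where "n = (int p - 1) div 2"
  have n: "int p = 2 * n + 1" using p_mod_4 unfolding n_def by presburger
  let ?f = "\<lambda>x. \<phi> (x * (x ^ 2 + c))"
  have "(\<Sum>x\<in>{n+1..2*n}. ?f x) = (\<Sum>x\<in>{1..n}. ?f x)"
  proof (rule sum.reindex_bij_witness[of _ "\<lambda>x. int p - x" "\<lambda>x. int p - x"])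
    fix x assume "x \<in> {n+1..2*n}"
    have "[int p - x = - x] (mod int p)" by (simp add: cong_iff_dvd_diff)
    hence "?f (int p - x) = ?f (- x)" using periodic_cubic_sum_term unfolding periodic_def by blast
    also have "- x * ((- x) ^ 2 + c) = - (x * (x ^ 2 + c))" by simp
    finally show "?f (int p - x) = ?f x" by (simp only: \<phi>_minus)
  qed (auto simp: n)
  moreover have "R1 = {1..n} \<union> {n+1..2*n}" using n p_gt_2 by auto
  moreover have "(\<Sum>x\<in>{1..n} \<union> {n+1..2*n}. ?f x)
      = (\<Sum>x\<in>{1..n}. ?f x) + (\<Sum>x\<in>{n+1..2*n}. ?f x)"
    by (rule sum.union_disjoint) auto
  ultimately have "cubic_sum c = 2 * (\<Sum>x\<in>{1..n}. ?f x)" unfolding cubic_sum_def sum_R by simp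
  thus ?thesis by simp
qed

lemma cubic_sum_two_squares:
  assumes "\<not> int p dvd b"
  shows "\<exists>A B. cubic_sum b = 2 * A \<and> int p = A ^ 2 + B ^ 2"
proof -
  obtain g where g: "\<phi> g = -1" using nonresidue_exists by blast
  obtain A where A: "cubic_sum b = 2 * A" using cubic_sum_even by blast
  obtain B where B: "cubic_sum (b * g) = 2 * B" using cubic_sum_even by blast
  have "int p = A ^ 2 + B ^ 2" using jacobsthal[OF assms g] unfolding A B by (simp add: power_mult_distrib)
  with A show ?thesis by blast
qed

end

section \<open>Points on the Franel cubic\<close>

lemma dvd_card_order_3:
  assumes "finite V" "\<And>v. v \<in> V
      \<Longrightarrow> r v \<in> V" "\<And>v. v \<in> V
          \<Longrightarrow> r (r (r v)) = v" "\<And>v. v \<in> V \<Longrightarrow> r v \<noteq> v"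
  shows "3 dvd card V"
proof -
  let ?C = "(\<lambda>v. {v, r v, r (r v)}) ` V"
  have ne: "r (r v) \<noteq> v" "r (r v) \<noteq> r v" if "v \<in> V" for v
  proof -
    show "r (r v) \<noteq> v" using assms(3)[OF that] assms(4)[OF that] by auto
    show "r (r v) \<noteq> r v" using assms(4)[OF assms(2)[OF that]] .
  qed
  have "3 * card ?C = card (\<Union>?C)"
  proof (rule card_partition)
    show "finite ?C" "finite (\<Union>?C)" using assms(1) by auto
    show "card c = 3" if "c \<in> ?C" for c
    proof -
      from that obtain v where "c = {v, r v, r (r v)}" "v \<in> V" by (rule imageE)
      thus ?thesis using assms(4)[of v] ne[of v] by (auto simp: card_insert_if)
    qed
    show "c1 \<inter> c2 = {}" if "c1 \<in> ?C" "c2 \<in> ?C" "c1 \<noteq> c2" for c1 c2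
    proof (rule ccontr)
      assume "c1 \<inter> c2 \<noteq> {}"
      then obtain u where u: "u \<in> c1" "u \<in> c2" by auto
      have "c = {u, r u, r (r u)}" if c: "c \<in> ?C" and u: "u \<in> c" for c
      proof -
        obtain v where v: "v \<in> V" "c = {v, r v, r (r v)}" using c by auto
        have "r (r (r v)) = v" by (rule assms(3)[OF v(1)])
        thus ?thesis using u v(2) by auto
      qed
      from this[OF that(1) u(1)] this[OF that(2) u(2)] show False using that(3) by simp
    qed
  qed
  moreover have "\<Union>?C = V" using assms(2) by auto
  ultimately show ?thesis by (metis dvd_triv_left)
qed

context odd_prime begin

text \<open>
  The curve \<open>(1 + x) (1 + y) (1 + 1/(xy)) = w\<close> in the torus, multiplied by \<open>xy\<close>. It is fibered by
  \<open>t = x / (x + 1)\<^sup>2\<close>. The discriminant in \<open>y\<close> is \<open>fibre_disc w t\<close> up to a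
  fourth power, and \<open>x\<close> is a root of a quadratic with discriminant \<open>1 - 4t\<close>.
\<close>
definition torus_cubic :: "int \<Rightarrow> int \<Rightarrow> int \<Rightarrow> int" where
  "torus_cubic w x y = (1 + x) * (1 + y) * (1 + x * y) - w * (x * y)"
definition torus_count :: "int \<Rightarrow> int" where
  "torus_count w = (\<Sum>x\<in>R1. \<Sum>y\<in>R1. of_bool (int p dvd torus_cubic w x y))"
definition fibre_disc :: "int \<Rightarrow> int \<Rightarrow> int" where "fibre_disc w t
    = (1 - w * t) ^ 2 - 4 * t"

lemma count_cubic_in_y:
  assumes x: "x \<in> R1" and w: "\<not> int p dvd w"
  shows "(\<Sum>y\<in>R1. of_bool (int p dvd torus_cubic w x y))
      = of_bool (\<not> int p dvd x + 1) * (1 + \<phi> (((x + 1) ^ 2 - w * x) ^ 2 - 4 * x * (x + 1) ^ 2))"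
proof (cases "int p dvd x + 1")
  case True
  have "\<not> int p dvd torus_cubic w x y" if "y \<in> R1" for y
  proof
    assume "int p dvd torus_cubic w x y"
    moreover have "int p dvd (x + 1) * ((1 + y) * (1 + x * y))" using True by (rule dvd_mult2)
    ultimately have "int p dvd (x + 1) * ((1 + y) * (1 + x * y)) - torus_cubic w x y"
        by (rule dvd_diff[rotated])
    also have "(x + 1) * ((1 + y) * (1 + x * y)) - torus_cubic w x y = w * (x * y)"
        by (simp add: torus_cubic_def algebra_simps)
    finally show False using w dvd_R1[OF x] dvd_R1[OF that] p_dvd_mult by blast
  qed
  hence "(\<Sum>y\<in>R1. of_bool (int p dvd torus_cubic w x y) :: int) = 0" by (intro sum.neutral) simp
  thus ?thesis using True by simp
next
  case False
  have F: "torus_cubic w x y = (x * (x + 1)) * y ^ 2 + ((x + 1) ^ 2 - w * x) * y + (x + 1)" for y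
    by (simp add: torus_cubic_def power2_eq_square algebra_simps)
  have n: "\<not> int p dvd x * (x + 1)" using False dvd_R1[OF x] p_dvd_mult by blast
  have "(\<Sum>y\<in>R. of_bool (int p dvd torus_cubic w x y))
      = 1 + \<phi> (((x + 1) ^ 2 - w * x) ^ 2 - 4 * (x * (x + 1)) * (x + 1))"
    unfolding F by (rule count_quadratic[OF n])
  moreover have "4 * (x * (x + 1)) * (x + 1) = 4 * x * (x + 1) ^ 2" by (simp add: power2_eq_square)
  moreover have "\<not> int p dvd torus_cubic w x 0" using False by (simp add: torus_cubic_def add.commute)
  ultimately show ?thesis using False unfolding sum_R by simp
qed

lemma count_parameter:
  assumes x: "x \<in> R1"
  shows "(\<Sum>t\<in>R1. of_bool (int p dvd t * (x + 1) ^ 2 - x) * (1 + \<phi> (fibre_disc w t)))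
      = of_bool (\<not> int p dvd x + 1) * (1 + \<phi> (((x + 1) ^ 2 - w * x) ^ 2 - 4 * x * (x + 1) ^ 2))"
proof (cases "int p dvd x + 1")
  case True
  have "\<not> int p dvd t * (x + 1) ^ 2 - x" for t
  proof
    assume "int p dvd t * (x + 1) ^ 2 - x"
    moreover have "int p dvd t * (x + 1) ^ 2" using True by (simp add: power2_eq_square)
    ultimately have "int p dvd t * (x + 1) ^ 2 - (t * (x + 1) ^ 2 - x)" by (rule dvd_diff[rotated])
    thus False using dvd_R1[OF x] by simp
  qed
  thus ?thesis using True by simp
next
  case False
  let ?s = "(x + 1) ^ 2" and ?D = "((x + 1) ^ 2 - w * x) ^ 2 - 4 * x * (x + 1) ^ 2"
  have s: "\<not> int p dvd ?s" using False p_dvd_power by blast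
  have "(\<Sum>t\<in>R1. of_bool (int p dvd t * ?s - x) * (1 + \<phi> (fibre_disc w t)))
      = (\<Sum>t\<in>R1. of_bool (int p dvd ?s * t + (- x)) * (1 + \<phi> ?D))"
  proof (rule sum.cong[OF refl])
    fix t
    have "\<phi> (fibre_disc w t) = \<phi> ?D" if "int p dvd t * ?s - x"
    proof -
      have "[t * ?s = x] (mod int p)" using that by (simp add: cong_iff_dvd_diff)
      hence "[(?s - w * (t * ?s)) ^ 2 - 4 * (t * ?s) * ?s = ?D] (mod int p)"
        by (intro cong_diff cong_pow cong_mult cong_refl)
      hence "\<phi> ((?s - w * (t * ?s)) ^ 2 - 4 * (t * ?s) * ?s) = \<phi> ?D" by (rule \<phi>_cong)
      moreover have "(?s - w * (t * ?s)) ^ 2 - 4 * (t * ?s) * ?s = ?s ^ 2 * fibre_disc w t"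
        unfolding fibre_disc_def by (simp add: power2_eq_square algebra_simps)
      ultimately show ?thesis by (simp only: \<phi>_square_mult[OF s])
    qed
    moreover have e: "?s * t + (- x) = t * ?s - x" by simp
    ultimately show "of_bool (int p dvd t * ?s - x) * (1 + \<phi> (fibre_disc w t))
        = of_bool (int p dvd ?s * t + (- x)) * (1 + \<phi> ?D)"
      unfolding e by (cases "int p dvd t * ?s - x") simp_all
  qed
  also have "\<dots> = (\<Sum>t\<in>R1. of_bool (int p dvd ?s * t + (- x))) * (1 + \<phi> ?D)"
      by (simp only: sum_distrib_right)
  also have "(\<Sum>t\<in>R1. of_bool (int p dvd ?s * t + (- x)) :: int) = 1"
    using count_linear[OF s, of "- x"] dvd_R1[OF x] unfolding sum_R by simp
  finally show ?thesis using False by simp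
qed

lemma count_points_over_parameter:
  assumes t: "t \<in> R1"
  shows "(\<Sum>x\<in>R1. of_bool (int p dvd t * (x + 1) ^ 2 - x)) = 1 + \<phi> (1 - 4 * t)"
proof -
  have "t * (x + 1) ^ 2 - x = t * x ^ 2 + (2 * t - 1) * x + t" for x
    by (simp add: power2_eq_square algebra_simps)
  hence "(\<Sum>x\<in>R. of_bool (int p dvd t * (x + 1) ^ 2 - x)) = 1 + \<phi> ((2 * t - 1) ^ 2 - 4 * t * t)"
    by (simp only: count_quadratic[OF dvd_R1[OF t]])
  moreover have "(2 * t - 1) ^ 2 - 4 * t * t = 1 - 4 * t" by (simp add: power2_eq_square algebra_simps)
  ultimately show ?thesis using dvd_R1[OF t] unfolding sum_R by simp
qed

text \<open>
  The points over \<open>t\<close> number \<open>(1 + \<phi> (1 - 4t)) (1 + \<phi> (fibre_disc w t))\<close>. Extending the sum to \<open>t = 0\<close>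
  adds \<open>4\<close>, the sum over the conic contributes \<open>-1\<close>, and the linear sum vanishes.
\<close>
lemma torus_count_eq_sum:
  assumes w: "\<not> int p dvd w" and w1: "\<not> int p dvd w + 1"
  shows "torus_count w = int p - 5 + (\<Sum>t\<in>R. \<phi> ((1 - 4 * t) * fibre_disc w t))"
proof -
  have "torus_count w = (\<Sum>x\<in>R1. \<Sum>t\<in>R1. of_bool (int p dvd t * (x + 1) ^ 2
      - x) * (1 + \<phi> (fibre_disc w t)))"
    unfolding torus_count_def by (rule sum.cong[OF refl]) (simp only: count_cubic_in_y[OF _ w] count_parameter)
  also have "\<dots> = (\<Sum>t\<in>R1. \<Sum>x\<in>R1. of_bool (int p dvd t * (x + 1) ^ 2
      - x) * (1 + \<phi> (fibre_disc w t)))" by (rule sum.swap)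
  also have "\<dots> = (\<Sum>t\<in>R1. (1 + \<phi> (1 - 4 * t)) * (1 + \<phi> (fibre_disc w t)))"
    by (intro sum.cong refl) (simp only: sum_distrib_right[symmetric] count_points_over_parameter)
  also have "\<dots> = (\<Sum>t\<in>R. (1 + \<phi> (1 - 4 * t)) * (1 + \<phi> (fibre_disc w t))) - 4"
    unfolding sum_R by (simp add: fibre_disc_def)
  also have "(\<Sum>t\<in>R. (1 + \<phi> (1 - 4 * t)) * (1 + \<phi> (fibre_disc w t)))
      = (\<Sum>t\<in>R. 1) + (\<Sum>t\<in>R. \<phi> (fibre_disc w t))
      + (\<Sum>t\<in>R. \<phi> ((-4) * t + 1)) + (\<Sum>t\<in>R. \<phi> ((1 - 4 * t) * fibre_disc w t))"
    unfolding sum.distrib[symmetric]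
  proof (rule sum.cong[OF refl])
    fix t :: int
    have e: "(-4) * t + 1 = 1 - 4 * t" by simp
    show "(1 + \<phi> (1 - 4 * t)) * (1 + \<phi> (fibre_disc w t))
        = 1 + \<phi> (fibre_disc w t) + \<phi> ((-4) * t + 1) + \<phi> ((1 - 4 * t) * fibre_disc w t)"
      unfolding e \<phi>_mult by (simp only: distrib_left distrib_right mult_1 mult_1_right add_ac)
  qed
  also have "(\<Sum>t\<in>R. \<phi> ((-4) * t + 1)) = 0" by (rule sum_\<phi>) (use p_not_dvd_4 in simp)
  also have "(\<Sum>t\<in>R. \<phi> (fibre_disc w t)) = -1"
  proof -
    have "fibre_disc w t = w ^ 2 * t ^ 2 + (- (2 * w + 4)) * t + 1" for t
      by (simp add: fibre_disc_def power2_eq_square algebra_simps)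
    moreover have "(\<Sum>t\<in>R. \<phi> (w ^ 2 * t ^ 2 + (- (2 * w + 4)) * t + 1)) = - \<phi> (w ^ 2)"
    proof (rule sum_\<phi>_quadratic)
      show "\<not> int p dvd w ^ 2" using w p_dvd_power by blast
      have "(- (2 * w + 4)) ^ 2 - 4 * w ^ 2 * 1 = 4 * (4 * (w + 1))"
          by (simp add: power2_eq_square algebra_simps)
      thus "\<not> int p dvd (- (2 * w + 4)) ^ 2 - 4 * w ^ 2 * 1" using w1 p_not_dvd_4
          by (simp only: p_dvd_mult) simp
    qed
    ultimately show ?thesis by (simp only: \<phi>_square[OF w])
  qed
  finally show ?thesis using p_gt_2 by simp
qed

text \<open>
  In the variable \<open>u = 1 - 4t\<close> the quadratic factor becomes
  \<open>w\<^sup>2 u\<^sup>2 - 2 (w\<^sup>2 - 4w - 8) u + w (w - 8)\<close> up to the square \<open>16\<close>. Its linear term vanishes exactly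
  for the given \<open>w\<close>, which is what makes the curve one with complex multiplication by \<open>i\<close>.
\<close>
lemma sum_eq_cubic_sum:
  assumes w: "\<not> int p dvd w" and ww: "[w ^ 2 = 4 * w + 8] (mod int p)"
  shows "(\<Sum>t\<in>R. \<phi> ((1 - 4 * t) * fibre_disc w t)) = cubic_sum (w ^ 3 * (w - 8))"
proof -
  let ?f = "\<lambda>x. \<phi> (x * (w ^ 2 * x ^ 2 + w * (w - 8)))"
  have per: "periodic ?f" by (intro periodic_\<phi> cong_mult cong_add cong_pow cong_refl)
  have "\<phi> ((1 - 4 * t) * fibre_disc w t) = ?f ((-4) * t + 1)" for t
  proof -
    have e: "4 ^ 2 * ((1 - 4 * t) * fibre_disc w t) = (1 - 4 * t) * (w ^ 2 * (1 - 4 * t) ^ 2 + w * (w - 8))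
        - (1 - 4 * t) ^ 2 * 2 * (w ^ 2 - (4 * w + 8))"
      unfolding fibre_disc_def by (simp add: power2_eq_square algebra_simps)
    have "[4 ^ 2 * ((1 - 4 * t) * fibre_disc w t) = (1 - 4 * t) * (w ^ 2 * (1 - 4 * t) ^ 2 + w * (w
        - 8))] (mod int p)"
      unfolding e cong_iff_dvd_diff using ww by (simp add: cong_iff_dvd_diff)
    hence "\<phi> (4 ^ 2 * ((1 - 4 * t) * fibre_disc w t))
        = \<phi> ((1 - 4 * t) * (w ^ 2 * (1 - 4 * t) ^ 2 + w * (w - 8)))"
      by (rule \<phi>_cong)
    moreover have "(-4) * t + 1 = 1 - 4 * t" by simp
    ultimately show ?thesis by (simp only: \<phi>_square_mult[OF p_not_dvd_4])
  qed
  hence "(\<Sum>t\<in>R. \<phi> ((1 - 4 * t) * fibre_disc w t)) = (\<Sum>t\<in>R. ?f ((-4) * t + 1))"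
      by (simp only:)
  also have "\<dots> = (\<Sum>x\<in>R. ?f x)" by (rule sum_affine[OF _ per]) (use p_not_dvd_4 in simp)
  also have "\<dots> = (\<Sum>x\<in>R. \<phi> ((w ^ 2 * x + 0) * ((w ^ 2 * x + 0) ^ 2 + w ^ 3 * (w - 8))))"
  proof (rule sum.cong[OF refl])
    fix x
    have w2: "\<not> int p dvd w ^ 2" using w p_dvd_power by blast
    have "(w ^ 2 * x + 0) * ((w ^ 2 * x + 0) ^ 2 + w ^ 3 * (w - 8))
        = (w ^ 2) ^ 2 * (x * (w ^ 2 * x ^ 2 + w * (w - 8)))"
      by (simp add: power2_eq_square power3_eq_cube algebra_simps)
    thus "?f x = \<phi> ((w ^ 2 * x + 0) * ((w ^ 2 * x + 0) ^ 2 + w ^ 3 * (w - 8)))"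
      by (simp only: \<phi>_square_mult[OF w2])
  qed
  also have "\<dots> = cubic_sum (w ^ 3 * (w - 8))"
    unfolding cubic_sum_def by (rule sum_affine[OF _ periodic_cubic_sum_term]) (use w p_dvd_power in blast)
  finally show ?thesis .
qed

text \<open>
  With \<open>s = 1/(xy)\<close> the points are the solutions of \<open>(1 + x) (1 + y) (1 + s) = w\<close> and \<open>xys = 1\<close>, on which the cyclic
  rotation acts. A fixed point satisfies \<open>x\<^sup>3 = 1\<close>, which forces \<open>w = 8\<close> or \<open>w = -1\<close>;
  neither is a root of \<open>w\<^sup>2 = 4w + 8\<close> modulo a prime greater than \<open>3\<close>.
\<close>
lemma three_dvd_torus_count:
  assumes p3: "p > 3" and ww: "[w ^ 2 = 4 * w + 8] (mod int p)"
  shows "3 dvd torus_count w"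
proof -
  define V where "V = {(x, y, s). x \<in> R1 \<and> y \<in> R1 \<and> s \<in> R1 \<and> int p dvd x * y * s - 1
                          \<and> int p dvd (1 + x) * (1 + y) * (1 + s) - w}"
  have wd: "int p dvd w ^ 2 - (4 * w + 8)" using ww by (simp add: cong_iff_dvd_diff)
  have finV: "finite V" by (rule finite_subset[of _ "R1 \<times> R1 \<times> R1"]) (auto simp: V_def)
  have "3 dvd card V"
  proof (rule dvd_card_order_3[OF finV, of "\<lambda>(x, y, s). (y, s, x)"])
    let ?r = "\<lambda>(x :: int, y :: int, s :: int). (y, s, x)"
    fix v assume v: "v \<in> V"
    then obtain x y s where xys: "v = (x, y, s)" by (cases v)
    have "int p dvd x * y * s - 1" using v by (simp add: xys V_def)
    also have "x * y * s - 1 = y * s * x - 1" by simp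
    finally have d1: "int p dvd y * s * x - 1" .
    have "int p dvd (1 + x) * (1 + y) * (1 + s) - w" using v by (simp add: xys V_def)
    also have "(1 + x) * (1 + y) * (1 + s) - w = (1 + y) * (1 + s) * (1 + x) - w" by (simp only: mult_ac)
    finally have "int p dvd (1 + y) * (1 + s) * (1 + x) - w" .
    with d1 show "?r v \<in> V" using v by (simp add: xys V_def)
    show "?r (?r (?r v)) = v" by (simp add: xys)
    show "?r v \<noteq> v"
    proof (rule notI)
      assume "?r v = v"
      hence "y = x \<and> s = y \<and> x = s" unfolding xys prod.case prod.inject .
      hence e: "y = x" "s = x" by blast+
      have d1: "int p dvd x * x * x - 1" and d2: "int p dvd (1 + x) * (1 + x) * (1 + x) - w"
        using v by (auto simp: xys V_def e)
      have "int p dvd (x - 1) * (x ^ 2 + x + 1)"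
      proof -
        have "(x - 1) * (x ^ 2 + x + 1) = x * x * x - 1" by (simp add: power2_eq_square algebra_simps)
        thus ?thesis using d1 by simp
      qed
      hence "int p dvd x - 1 \<or> int p dvd x ^ 2 + x + 1" by (simp only: p_dvd_mult)
      hence "int p dvd w - 8 \<or> int p dvd w + 1"
      proof
        assume a: "int p dvd x - 1"
        have "w - 8 = (x - 1) * (x ^ 2 + 4 * x + 7) - ((1 + x) * (1 + x) * (1 + x) - w)"
          by (simp add: power2_eq_square algebra_simps)
        moreover have "int p dvd (x - 1) * (x ^ 2 + 4 * x + 7) - ((1 + x) * (1 + x) * (1 + x) - w)"
          by (rule dvd_diff[OF dvd_mult2[OF a] d2])
        ultimately show ?thesis by (simp only: simp_thms)
      next
        assume a: "int p dvd x ^ 2 + x + 1"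
        have "w + 1 = (x ^ 2 + x + 1) * (x + 2) - ((1 + x) * (1 + x) * (1 + x) - w)"
          by (simp add: power2_eq_square algebra_simps)
        moreover have "int p dvd (x ^ 2 + x + 1) * (x + 2) - ((1 + x) * (1 + x) * (1 + x) - w)"
          by (rule dvd_diff[OF dvd_mult2[OF a] d2])
        ultimately show ?thesis by (simp only: simp_thms)
      qed
      hence "int p dvd 24 \<or> int p dvd 3"
      proof
        assume a: "int p dvd w - 8"
        have "24 = (w ^ 2 - (4 * w + 8)) - (w - 8) * (w + 4)"
          by (simp add: power2_eq_square algebra_simps)
        moreover have "int p dvd (w ^ 2 - (4 * w + 8)) - (w - 8) * (w + 4)"
          by (rule dvd_diff[OF wd dvd_mult2[OF a]])
        ultimately show ?thesis by (simp only: simp_thms)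
      next
        assume a: "int p dvd w + 1"
        have "3 = (w + 1) * (w - 5) - (w ^ 2 - (4 * w + 8))"
          by (simp add: power2_eq_square algebra_simps)
        moreover have "int p dvd (w + 1) * (w - 5) - (w ^ 2 - (4 * w + 8))"
          by (rule dvd_diff[OF dvd_mult2[OF a] wd])
        ultimately show ?thesis by (simp only: simp_thms)
      qed
      moreover have "\<not> int p dvd 3" using p3 by (auto dest: zdvd_imp_le)
      moreover have "\<not> int p dvd 24"
      proof
        assume "int p dvd 24"
        hence "int p dvd 2 * (4 * 3)" by simp
        thus False using p_not_dvd_2 p_not_dvd_4 \<open>\<not> int p dvd 3\<close>
            by (simp only: p_dvd_mult) simp
      qed
      ultimately show False by (elim disjE) simp_all
    qed
  qed
  moreover have "torus_count w = int (card V)"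
  proof -
    have "torus_count w = (\<Sum>x\<in>R1. \<Sum>y\<in>R1. \<Sum>s\<in>R1. of_bool (int p dvd x * y * s
        - 1 \<and> int p dvd (1 + x) * (1 + y) * (1 + s) - w))"
      unfolding torus_count_def
    proof (intro sum.cong refl)
      fix x y assume xy: "x \<in> R1" "y \<in> R1"
      have n: "\<not> int p dvd x * y" using dvd_R1[OF xy(1)] dvd_R1[OF xy(2)] p_dvd_mult by blast
      have "(\<Sum>s\<in>R1. of_bool (int p dvd x * y * s
          - 1 \<and> int p dvd (1 + x) * (1 + y) * (1 + s) - w) :: int)
          = (\<Sum>s\<in>R1. of_bool (int p dvd x * y * s + (- 1)) * of_bool (int p dvd torus_cubic w x y))"
      proof (rule sum.cong[OF refl])
        fix s
        have "int p dvd (1 + x) * (1 + y) * (1 + s) - w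
            \<longleftrightarrow> int p dvd torus_cubic w x y" if a: "int p dvd x * y * s - 1"
        proof -
          have "torus_cubic w x y = (x * y) * ((1 + x) * (1 + y) * (1 + s) - w) - (x * y * s
              - 1) * ((1 + x) * (1 + y))"
            by (simp add: torus_cubic_def algebra_simps)
          hence "int p dvd torus_cubic w x y \<longleftrightarrow> int p dvd (x * y) * ((1 + x) * (1
              + y) * (1 + s) - w)"
            using dvd_mult2[OF a, of "(1 + x) * (1 + y)"] by (simp only: dvd_diff_left_iff)
          thus ?thesis using n p_dvd_mult by blast
        qed
        moreover have e: "x * y * s + (- 1) = x * y * s - 1" by simp
        ultimately show "(of_bool (int p dvd x * y * s - 1 \<and> int p dvd (1 + x) * (1 + y) * (1 + s)
            - w) :: int)
          = of_bool (int p dvd x * y * s + (- 1)) * of_bool (int p dvd torus_cubic w x y)"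
          unfolding e of_bool_conj[symmetric] by (intro arg_cong[of _ _ of_bool]) blast
      qed
      also have "\<dots> = (\<Sum>s\<in>R1. of_bool (int p dvd x * y * s
          + (- 1))) * of_bool (int p dvd torus_cubic w x y)"
        by (simp only: sum_distrib_right)
      also have "(\<Sum>s\<in>R1. of_bool (int p dvd x * y * s + (- 1)) :: int) = 1"
        using count_linear[OF n, of "- 1"] p_gt_2 unfolding sum_R by simp
      finally show "of_bool (int p dvd torus_cubic w x y)
          = (\<Sum>s\<in>R1. of_bool (int p dvd x * y * s
          - 1 \<and> int p dvd (1 + x) * (1 + y) * (1 + s) - w) :: int)"
        by simp
    qed
    also have "\<dots> = (\<Sum>v\<in>R1 \<times> R1 \<times> R1. of_bool (v \<in> V))"
      unfolding sum.cartesian_product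
    proof (rule sum.cong[OF refl])
      fix v assume "v \<in> R1 \<times> R1 \<times> R1"
      then obtain x y s where v: "v = (x, y, s)" "x \<in> R1" "y \<in> R1" "s \<in> R1" by (elim SigmaE) simp
      thus "(case v of (x, y, s) \<Rightarrow> of_bool (int p dvd x * y * s
          - 1 \<and> int p dvd (1 + x) * (1 + y) * (1 + s) - w))
          = (of_bool (v \<in> V) :: int)"
        by (simp add: V_def del: atLeastLessThan_iff)
    qed
    also have "\<dots> = int (card V)"
    proof -
      have "(R1 \<times> R1 \<times> R1) \<inter> {v. v \<in> V} = V" by (auto simp: V_def)
      thus ?thesis by (simp del: Collect_mem_eq)
    qed
    finally show ?thesis .
  qed
  ultimately show ?thesis by (metis of_nat_dvd_iff of_nat_numeral)
qed

end

context odd_prime begin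

section \<open>The point count modulo p\<close>

lemma sum_powers:
  "[(\<Sum>x\<in>R1. x ^ m) = (if (p - 1) dvd m then -1 else 0)] (mod int p)"
proof (cases "(p - 1) dvd m")
  case True
  then obtain c where m: "m = (p - 1) * c" by (elim dvdE)
  have "[(\<Sum>x\<in>R1. x ^ m) = (\<Sum>x\<in>R1. 1)] (mod int p)"
  proof (rule cong_sum)
    fix x assume "x \<in> R1"
    hence "[(x ^ (p - 1)) ^ c = 1 ^ c] (mod int p)" by (intro cong_pow fermat_int prime_p dvd_R1)
    thus "[x ^ m = 1] (mod int p)" by (simp add: m power_mult)
  qed
  also have "(\<Sum>x\<in>R1. 1) = int p - 1" using p_gt_2 by simp
  also have "[int p - 1 = -1] (mod int p)" by (simp add: cong_iff_dvd_diff)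
  finally show ?thesis using True by simp
next
  case False
  hence m0: "m > 0" by (cases m) auto
  obtain g where "residue_primroot p g" using prime_primitive_root_exists[OF prime_gt_1_nat[OF prime_p]] prime_p by auto
  hence g: "coprime p g" "ord p g = p - 1" using prime_p by (auto simp: residue_primroot_def totient_prime)
  have gm: "\<not> [g ^ m = 1] (mod p)" using ord_divides[of g m p] False g(2) by (simp only:) simp
  have pg: "\<not> int p dvd int g" using g(1) prime_p by
      (auto simp: coprime_absorb_left prime_gt_1_nat dest: prime_gt_1_nat)
  let ?S = "\<Sum>x\<in>R1. x ^ m"
  have S: "(\<Sum>x\<in>R. x ^ m) = ?S" using m0 unfolding sum_R by simp
  have per: "periodic (\<lambda>x. x ^ m mod int p)" unfolding periodic_def
    using cong_pow unfolding cong_def by blast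
  have "[int g ^ m * ?S = (\<Sum>x\<in>R. (int g * x + 0) ^ m)] (mod int p)"
    by (simp add: S[symmetric] sum_distrib_left power_mult_distrib)
  also have "[(\<Sum>x\<in>R. (int g * x + 0) ^ m) = (\<Sum>x\<in>R. (int g * x
      + 0) ^ m mod int p)] (mod int p)"
    by (rule cong_sum) simp
  also have "(\<Sum>x\<in>R. (int g * x + 0) ^ m mod int p) = (\<Sum>x\<in>R. x ^ m mod int p)"
    by (rule sum_affine[OF pg per])
  also have "[(\<Sum>x\<in>R. x ^ m mod int p) = (\<Sum>x\<in>R. x ^ m)] (mod int p)"
    by (rule cong_sum) simp
  finally have "int p dvd int g ^ m * ?S - ?S" unfolding S by (simp only: cong_iff_dvd_diff)
  also have "int g ^ m * ?S - ?S = (int g ^ m - 1) * ?S" by (simp add: algebra_simps)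
  finally have "int p dvd int g ^ m - 1 \<or> int p dvd ?S" by (simp only: p_dvd_mult)
  moreover have "\<not> int p dvd int g ^ m - 1"
  proof
    assume "int p dvd int g ^ m - 1"
    hence "[int (g ^ m) = int 1] (mod int p)" by (simp add: cong_iff_dvd_diff)
    thus False using gm by (simp only: cong_int_iff)
  qed
  ultimately show ?thesis using False by (simp add: cong_0_iff)
qed

lemma exponent_dvd_below:
  assumes "k < p - 1" "i \<le> k" "l \<le> k"
  shows "(p - 1) dvd i + l + (p - 1 - k) \<longleftrightarrow> i = k - l"
proof
  assume "(p - 1) dvd i + l + (p - 1 - k)"
  then obtain c where c: "i + l + (p - 1 - k) = (p - 1) * c" by (elim dvdE)
  have "c < 2"
  proof (rule ccontr)
    assume "\<not> c < 2"
    hence "(p - 1) * 2 \<le> (p - 1) * c" by (intro mult_le_mono2) simp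
    thus False using c assms by linarith
  qed
  moreover have "c \<noteq> 0"
  proof
    assume "c = 0"
    hence "i + l + (p - 1 - k) = 0" using c by simp
    thus False using assms(1) by linarith
  qed
  ultimately have "c = 1" by simp
  thus "i = k - l" using c assms by simp
qed (use assms in simp)

lemma exponent_dvd_top:
  assumes "i \<le> p - 1" "l \<le> p - 1"
  shows "(p - 1) dvd i + l \<longleftrightarrow> i = p - 1 - l \<or> (i = 0 \<and> l = 0) \<or> (i
      = p - 1 \<and> l = p - 1)"
proof
  assume "(p - 1) dvd i + l"
  then obtain c where c: "i + l = (p - 1) * c" by (elim dvdE)
  have "c \<le> 2"
  proof (rule ccontr)
    assume "\<not> c \<le> 2"
    hence "(p - 1) * 3 \<le> (p - 1) * c" by (intro mult_le_mono2) simp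
    thus False using c assms p_gt_2 by linarith
  qed
  hence "c = 0 \<or> c = 1 \<or> c = 2" by linarith
  thus "i = p - 1 - l \<or> (i = 0 \<and> l = 0) \<or> (i = p - 1 \<and> l = p - 1)" using c assms by auto
next
  assume "i = p - 1 - l \<or> (i = 0 \<and> l = 0) \<or> (i = p - 1 \<and> l = p - 1)"
  hence "i + l = (p - 1) * 1 \<or> i + l = (p - 1) * 0 \<or> i + l = (p - 1) * 2" using assms by auto
  thus "(p - 1) dvd i + l" by (metis dvd_triv_left)
qed

definition row_sum :: "nat \<Rightarrow> nat \<Rightarrow> int" where
  "row_sum k l = (\<Sum>x\<in>R1. (1 + x) ^ k * x ^ (l + (p - 1 - k)))"

lemma row_sum_cong:
  "[row_sum k l = - (\<Sum>i\<le>k. int (k choose i) * of_bool ((p - 1) dvd i + l + (p - 1 - k)))] (mod int p)"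
proof -
  have "row_sum k l = (\<Sum>x\<in>R1. \<Sum>i\<le>k. int (k choose i) * x ^ (i + l + (p - 1 - k)))"
    unfolding row_sum_def
  proof (rule sum.cong[OF refl])
    fix x
    have b: "(1 + x) ^ k = (\<Sum>i\<le>k. int (k choose i) * x ^ i)"
      using binomial_ring[of x 1 k] by (simp add: add.commute)
    show "(1 + x) ^ k * x ^ (l + (p - 1 - k)) = (\<Sum>i\<le>k. int (k choose i) * x ^ (i + l + (p - 1 - k)))"
      unfolding b sum_distrib_right by (intro sum.cong refl) (simp add: power_add mult_ac)
  qed
  also have "\<dots> = (\<Sum>i\<le>k. int (k choose i) * (\<Sum>x\<in>R1. x ^ (i + l + (p - 1 - k))))"
    unfolding sum_distrib_left by (rule sum.swap)
  also have "[(\<Sum>i\<le>k. int (k choose i) * (\<Sum>x\<in>R1. x ^ (i + l + (p - 1 - k))))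
     = (\<Sum>i\<le>k. int (k choose i) * (if (p - 1) dvd i + l + (p - 1 - k) then -1 else 0))] (mod int p)"
    by (intro cong_sum cong_scalar_left sum_powers)
  also have "(\<Sum>i\<le>k. int (k choose i) * (if (p - 1) dvd i + l + (p - 1 - k) then -1 else 0))
     = - (\<Sum>i\<le>k. int (k choose i) * of_bool ((p - 1) dvd i + l + (p - 1 - k)))"
    unfolding sum_negf[symmetric] by (intro sum.cong refl) auto
  finally show ?thesis .
qed

text \<open>
  For \<open>k < p - 1\<close> the only exponent divisible by \<open>p - 1\<close> is the middle one. For \<open>k = p - 1\<close> the two extreme exponents
  \<open>0\<close> and \<open>2(p - 1)\<close> contribute as well; they are the source of the correction \<open>6\<close> in \<open>torus_moment_top\<close>.
\<close>
lemma row_sum_below: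
  assumes "k < p - 1" "l \<le> k"
  shows "[row_sum k l = - int (k choose l)] (mod int p)"
proof -
  have "(\<Sum>i\<le>k. int (k choose i) * of_bool ((p - 1) dvd i + l + (p - 1 - k)))
      = (\<Sum>i\<le>k. if i = k - l then int (k choose i) else 0)"
  proof (rule sum.cong[OF refl])
    fix i assume "i \<in> {..k}"
    hence "i \<le> k" by simp
    from exponent_dvd_below[OF assms(1) this assms(2)]
    show "int (k choose i) * of_bool ((p - 1) dvd i + l + (p - 1 - k)) = (if i
        = k - l then int (k choose i) else 0)"
      by (simp only: of_bool_def) simp
  qed
  also have "\<dots> = int (k choose l)" using assms(2) by (simp flip: binomial_symmetric)
  finally show ?thesis using row_sum_cong[of k l] by simp
qed

lemma row_sum_top:
  assumes "k = p - 1" "l \<le> k"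
  shows "[row_sum k l = - (int (k choose l) + of_bool (l = 0) + of_bool (l = k))] (mod int p)"
proof -
  have k0: "k > 0" using assms p_gt_2 by simp
  have "(\<Sum>i\<le>k. int (k choose i) * of_bool ((p - 1) dvd i + l + (p - 1 - k)))
      = (\<Sum>i\<le>k. (if i = k - l then int (k choose i) else 0) + (if i = 0 then of_bool (l
      = 0) else 0) + (if i = k then of_bool (l = k) else 0))"
  proof (intro sum.cong refl)
    fix i assume "i \<in> {..k}"
    hence "(p - 1) dvd i + l \<longleftrightarrow> i = k - l \<or> (i = 0 \<and> l = 0) \<or> (i
        = k \<and> l = k)"
      using exponent_dvd_top[of i l] assms by simp
    thus "int (k choose i) * of_bool ((p - 1) dvd i + l + (p - 1 - k))
      = (if i = k - l then int (k choose i) else 0) + (if i = 0 then of_bool (l = 0) else 0) + (if i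
      = k then of_bool (l = k) else 0)"
      using assms k0 by auto
  qed
  also have "\<dots> = int (k choose l) + of_bool (l = 0) + of_bool (l = k)"
    unfolding sum.distrib using assms(2) by (simp flip: binomial_symmetric)
  finally show ?thesis using row_sum_cong[of k l] by simp
qed

text \<open>
  Modulo \<open>p\<close> this is the sum over the torus of the \<open>k\<close>-th power of \<open>(1 + x) (1 + y) (1 + 1/(xy))\<close>, with the
  denominator \<open>(xy)^k\<close> absorbed by Fermat's theorem.
\<close>
definition torus_moment :: "nat \<Rightarrow> int" where
  "torus_moment k = (\<Sum>x\<in>R1. \<Sum>y\<in>R1. ((1 + x) * (1 + y) * (1
      + x * y)) ^ k * (x * y) ^ (p - 1 - k))"

lemma torus_moment_eq: "torus_moment k = (\<Sum>l\<le>k. int (k choose l) * (row_sum k l * row_sum k l))"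
proof -
  have "torus_moment k = (\<Sum>x\<in>R1. \<Sum>y\<in>R1. \<Sum>l\<le>k. int (k choose l) *
      (((1 + x) ^ k * x ^ (l + (p - 1 - k))) * ((1 + y) ^ k * y ^ (l + (p - 1 - k)))))"
    unfolding torus_moment_def
  proof (intro sum.cong refl)
    fix x y :: int
    have b: "(1 + x * y) ^ k = (\<Sum>l\<le>k. int (k choose l) * (x * y) ^ l)"
      using binomial_ring[of "x * y" 1 k] by (simp add: add.commute)
    show "((1 + x) * (1 + y) * (1 + x * y)) ^ k * (x * y) ^ (p - 1 - k)
        = (\<Sum>l\<le>k. int (k choose l) * (((1 + x) ^ k * x ^ (l + (p - 1
        - k))) * ((1 + y) ^ k * y ^ (l + (p - 1 - k)))))"
      unfolding power_mult_distrib[of _ "1 + x * y"] b sum_distrib_left sum_distrib_right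
      by (intro sum.cong refl) (simp add: power_add power_mult_distrib mult_ac)
  qed
  also have "\<dots> = (\<Sum>x\<in>R1. \<Sum>l\<le>k. \<Sum>y\<in>R1. int (k choose l) *
      (((1 + x) ^ k * x ^ (l + (p - 1 - k))) * ((1 + y) ^ k * y ^ (l + (p - 1 - k)))))"
    by (rule sum.cong[OF refl sum.swap])
  also have "\<dots> = (\<Sum>l\<le>k. \<Sum>x\<in>R1. \<Sum>y\<in>R1. int (k choose l) *
      (((1 + x) ^ k * x ^ (l + (p - 1 - k))) * ((1 + y) ^ k * y ^ (l + (p - 1 - k)))))"
    by (rule sum.swap)
  also have "\<dots> = (\<Sum>l\<le>k. int (k choose l) * (row_sum k l * row_sum k l))"
    unfolding row_sum_def sum_product by (simp only: sum_distrib_left)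
  finally show ?thesis .
qed

lemma torus_moment_below:
  assumes "k < p - 1" shows "[torus_moment k = int (franel k)] (mod int p)"
proof -
  have "[torus_moment k = (\<Sum>l\<le>k. int (k choose l) * ((- int (k choose l))
      * (- int (k choose l))))] (mod int p)"
    unfolding torus_moment_eq by (intro cong_sum cong_scalar_left cong_mult row_sum_below assms) auto
  thus ?thesis by (simp add: franel_def power3_eq_cube mult.assoc)
qed

lemma torus_moment_top: "[torus_moment (p - 1) = int (franel (p - 1)) + 6] (mod int p)"
proof -
  define k where "k = p - 1"
  have k: "k > 0" "k = p - 1" using p_gt_2 by (auto simp: k_def)
  have "[torus_moment k = (\<Sum>l\<le>k. int (k choose l) * ((- (int (k choose l) + of_bool (l
      = 0) + of_bool (l = k)))
      * (- (int (k choose l) + of_bool (l = 0) + of_bool (l = k)))))] (mod int p)"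
    unfolding torus_moment_eq by (intro cong_sum cong_scalar_left cong_mult row_sum_top k) auto
  also have "(\<Sum>l\<le>k. int (k choose l) * ((- (int (k choose l) + of_bool (l = 0) + of_bool (l = k)))
      * (- (int (k choose l) + of_bool (l = 0) + of_bool (l = k)))))
      = (\<Sum>l\<le>k. int (k choose l) ^ 3 + (if l = 0 then 3 else 0) + (if l = k then 3 else 0))"
    by (intro sum.cong refl) (use k in \<open>auto simp: power3_eq_cube algebra_simps\<close>)
  also have "\<dots> = int (franel k) + 6" by (simp add: sum.distrib franel_def)
  finally show ?thesis by (simp only: k_def)
qed

text \<open>
  The number \<open>1 - a^(p-1)\<close> is the indicator of \<open>a = 0\<close>. Applied to the equation of the cubic and expanded
  by the binomial theorem, it turns the count into a combination of the moments, hence of the Franel numbers.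
\<close>
lemma torus_count_cong:
  assumes zw: "[z * w = 1] (mod int p)"
  shows "[torus_count w = - 5 - poly (franel_poly p) z] (mod int p)"
proof -
  have pz: "\<not> int p dvd z" 
  proof
    assume "int p dvd z"
    hence "int p dvd z * w" by simp
    hence "int p dvd 1" using cong_dvd_iff[OF zw] by blast
    thus False using p_gt_2 by simp
  qed
  let ?B = "\<lambda>x y. (1 + x) * (1 + y) * (1 + x * y)"
  have pw: "Suc (p - 1) = p" using p_gt_2 by simp
  have ind: "[of_bool (int p dvd torus_cubic w x y) = 1
      - (\<Sum>k<p. z ^ k * (?B x y ^ k * (x * y) ^ (p - 1 - k)))] (mod int p)"
    for x y
  proof -
    define A where "A = z * ?B x y + (- (x * y))"
    have "[A = z * torus_cubic w x y] (mod int p)"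
    proof -
      have "A - z * torus_cubic w x y = (z * w - 1) * (x * y)"
          by (simp add: A_def torus_cubic_def algebra_simps)
      thus ?thesis using zw by (simp add: cong_iff_dvd_diff)
    qed
    hence "int p dvd A \<longleftrightarrow> int p dvd torus_cubic w x y" using pz p_dvd_mult cong_dvd_iff by blast
    hence "[of_bool (int p dvd torus_cubic w x y) = 1 - A ^ (p - 1)] (mod int p)"
    proof (cases "int p dvd A")
      case True
      hence "int p dvd A ^ (p - 1)" using p_gt_2 by (intro dvd_trans[OF True]) (simp add: dvd_power)
      thus ?thesis using True \<open>int p dvd A
          \<longleftrightarrow> int p dvd torus_cubic w x y\<close> by (simp add: cong_iff_dvd_diff)
    next
      case False
      hence "[A ^ (p - 1) = 1] (mod int p)" by (rule fermat_int[OF prime_p])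
      hence "[1 - A ^ (p - 1) = 1 - 1] (mod int p)" by (intro cong_diff cong_refl)
      thus ?thesis using False \<open>int p dvd A
          \<longleftrightarrow> int p dvd torus_cubic w x y\<close> by (simp add: cong_sym_eq)
    qed
    also have "A ^ (p - 1) = (\<Sum>k\<le>p-1. int ((p - 1) choose k) * (z * ?B x y) ^ k * (- (x
        * y)) ^ (p - 1 - k))"
      unfolding A_def by (rule binomial_ring)
    also have "[1 - (\<Sum>k\<le>p-1. int ((p - 1) choose k) * (z * ?B x y) ^ k * (- (x * y)) ^ (p - 1 - k))
       = 1 - (\<Sum>k\<le>p-1. z ^ k * (?B x y ^ k * (x * y) ^ (p - 1 - k)))] (mod int p)"
    proof (intro cong_diff cong_refl cong_sum)
      fix k assume k: "k \<in> {..p-1}"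
      have "[int ((p - 1) choose k) = (-1) ^ k] (mod int p)"
        using k p_gt_2 by (intro choose_prime_pred prime_p) auto
      hence "[int ((p - 1) choose k) * ((z * ?B x y) ^ k * (- (x * y)) ^ (p - 1 - k))
          = (-1) ^ k * ((z * ?B x y) ^ k * (- (x * y)) ^ (p - 1 - k))] (mod int p)"
        by (rule cong_scalar_right)
      moreover have "(-1) ^ k * ((z * ?B x y) ^ k * (- (x * y)) ^ (p - 1 - k))
          = z ^ k * (?B x y ^ k * (x * y) ^ (p - 1 - k))"
      proof -
        have ev: "even (p - 1)" using prime_p p_gt_2 by (simp add: prime_odd_nat)
        have "(- (x * y)) ^ (p - 1 - k) = (-1) ^ (p - 1 - k) * (x * y) ^ (p - 1 - k)"
          by (rule power_minus)
        moreover have "((-1) ^ k * (-1) ^ (p - 1 - k) :: int) = 1"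
        proof -
          have "k + (p - 1 - k) = p - 1" using k by simp
          thus ?thesis unfolding power_add[symmetric] using ev by simp
        qed
        ultimately show ?thesis by (simp add: power_mult_distrib mult_ac)
      qed
      ultimately show "[int ((p - 1) choose k) * (z * ?B x y) ^ k * (- (x * y)) ^ (p - 1 - k)
         = z ^ k * (?B x y ^ k * (x * y) ^ (p - 1 - k))] (mod int p)" by (simp only: mult.assoc)
    qed
    also have "{..p-1} = {..<p}" using pw by auto
    finally show ?thesis .
  qed
  have "[torus_count w = (\<Sum>x\<in>R1. \<Sum>y\<in>R1. 1
      - (\<Sum>k<p. z ^ k * (?B x y ^ k * (x * y) ^ (p - 1 - k))))] (mod int p)"
    unfolding torus_count_def by (intro cong_sum ind)
  also have "(\<Sum>x\<in>R1. \<Sum>y\<in>R1. 1 - (\<Sum>k<p. z ^ k * (?B x y ^ k * (x * y) ^ (p - 1 - k))))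
      = (int p - 1) * (int p - 1) - (\<Sum>k<p. z ^ k * torus_moment k)"
  proof -
    have "(\<Sum>x\<in>R1. \<Sum>y\<in>R1. \<Sum>k<p. z ^ k * (?B x y ^ k * (x * y) ^ (p - 1 - k)))
        = (\<Sum>x\<in>R1. \<Sum>k<p. \<Sum>y\<in>R1. z ^ k * (?B x y ^ k * (x * y) ^ (p - 1 - k)))"
      by (rule sum.cong[OF refl sum.swap])
    also have "\<dots> = (\<Sum>k<p. \<Sum>x\<in>R1. \<Sum>y\<in>R1. z ^ k * (?B x y ^ k * (x * y) ^ (p
        - 1 - k)))"
      by (rule sum.swap)
    also have "\<dots> = (\<Sum>k<p. z ^ k * torus_moment k)" unfolding torus_moment_def
        by (simp only: sum_distrib_left)
    finally show ?thesis using p_gt_2 by (simp add: sum_subtractf)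
  qed
  also have "[(int p - 1) * (int p - 1) - (\<Sum>k<p. z ^ k * torus_moment k)
      = (0 - 1) * (0 - 1) - (poly (franel_poly p) z + 6)] (mod int p)"
  proof (intro cong_diff cong_mult cong_refl)
    show "[int p = 0] (mod int p)" "[int p = 0] (mod int p)" by (simp_all add: cong_0_iff)
    have "[(\<Sum>k<p. z ^ k * torus_moment k) = (\<Sum>k<p. z ^ k * (int (franel k) + (if k
        = p - 1 then 6 else 0)))] (mod int p)"
    proof (intro cong_sum cong_scalar_left)
      fix k assume "k \<in> {..<p}"
      thus "[torus_moment k = int (franel k) + (if k = p - 1 then 6 else 0)] (mod int p)"
        using torus_moment_below[of k] torus_moment_top by (cases "k = p - 1") auto
    qed
    also have "(\<Sum>k<p. z ^ k * (int (franel k) + (if k = p - 1 then 6 else 0)))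
        = (\<Sum>k<p. z ^ k * int (franel k)) + (\<Sum>k<p. if k = p - 1 then z ^ (p - 1) * 6 else 0)"
      unfolding sum.distrib[symmetric] by (intro sum.cong refl) (auto simp: algebra_simps)
    also have "(\<Sum>k<p. z ^ k * int (franel k)) = poly (franel_poly p) z"
      by (simp add: franel_poly_def poly_sum poly_monom mult.commute)
    also have "(\<Sum>k<p. if k = p - 1 then z ^ (p - 1) * 6 else 0) = z ^ (p - 1) * 6"
      using p_gt_2 by simp
    also have "[poly (franel_poly p) z + z ^ (p - 1) * 6 = poly (franel_poly p) z + 1 * 6] (mod int p)"
      by (intro cong_add cong_mult cong_refl fermat_int prime_p pz)
    finally show "[(\<Sum>k<p. z ^ k * torus_moment k) = poly (franel_poly p) z + 6] (mod int p)" by simp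
  qed
  finally show ?thesis by (simp add: algebra_simps)
qed

end

section \<open>Sums of two squares and congruences between rationals\<close>

text \<open>
  By the two-square identity \<open>(ac + bd)\<^sup>2 + (ad - bc)\<^sup>2 = q\<^sup>2\<close>, so the multiple \<open>ad - bc\<close> of \<open>q\<close>
  is \<open>0\<close> or \<open>\<plusminus>q\<close>; in the latter case \<open>ac + bd = 0\<close>.
\<close>
lemma two_squares_unique_aux:
  fixes a b c d q :: int
  assumes q: "q > 0" "q = a ^ 2 + b ^ 2" "q = c ^ 2 + d ^ 2" and dvd: "q dvd a * d - b * c"
  shows "a ^ 2 = c ^ 2 \<or> a ^ 2 = d ^ 2"
proof -
  obtain t where t: "a * d - b * c = q * t" using dvd by (elim dvdE)
  have id: "(a * c + b * d) ^ 2 + (a * d - b * c) ^ 2 = q ^ 2"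
  proof -
    have "(a * c + b * d) ^ 2 + (a * d - b * c) ^ 2 = (a ^ 2 + b ^ 2) * (c ^ 2 + d ^ 2)"
      by (simp add: power2_eq_square algebra_simps)
    also have "\<dots> = q * q" unfolding q(2)[symmetric] q(3)[symmetric] ..
    finally show ?thesis by (simp add: power2_eq_square)
  qed
  have compl: "q - a ^ 2 = b ^ 2" "q - c ^ 2 = d ^ 2" using q(2,3) by simp_all
  have "t ^ 2 \<le> 1"
  proof -
    have "q ^ 2 * t ^ 2 \<le> q ^ 2 * 1"
      using id unfolding t by (simp add: power_mult_distrib) (metis le_add_same_cancel2 zero_le_power2)
    thus ?thesis using q(1) by simp
  qed
  hence "t ^ 2 = 0 \<or> t ^ 2 = 1" by (metis zero_le_power2 int_one_le_iff_zero_less le_less antisym)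
  thus ?thesis
  proof
    assume "t ^ 2 = 0"
    hence "(a * d) ^ 2 = (b * c) ^ 2" using t by simp
    hence "a ^ 2 * (q - c ^ 2) = (q - a ^ 2) * c ^ 2"
      unfolding compl by (simp add: power_mult_distrib)
    hence "q * (a ^ 2 - c ^ 2) = 0" by (simp add: algebra_simps)
    thus ?thesis using q(1) by simp
  next
    assume "t ^ 2 = 1"
    hence "(a * c + b * d) ^ 2 = 0" using id unfolding t by (simp add: power_mult_distrib)
    hence "a * c = - (b * d)" by simp
    hence "(a * c) ^ 2 = (b * d) ^ 2" by simp
    hence "a ^ 2 * c ^ 2 = (q - a ^ 2) * (q - c ^ 2)"
      unfolding compl by (simp add: power_mult_distrib)
    hence "q * (q - a ^ 2 - c ^ 2) = 0" by (simp add: algebra_simps)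
    hence "a ^ 2 = q - c ^ 2" using q(1) by simp
    thus ?thesis using q(3) by simp
  qed
qed

lemma two_squares_unique:
  fixes a b c d q :: int
  assumes "prime q" "q = a ^ 2 + b ^ 2" "q = c ^ 2 + d ^ 2"
  shows "a ^ 2 = c ^ 2 \<or> a ^ 2 = d ^ 2"
proof -
  have q0: "q > 0" using assms(1) by (simp add: prime_gt_0_int)
  have "(a * d - b * c) * (a * d - (- b) * c) = a ^ 2 * d ^ 2 - b ^ 2 * c ^ 2"
    by (simp add: power2_eq_square algebra_simps)
  also have "\<dots> = a ^ 2 * (q - c ^ 2) - (q - a ^ 2) * c ^ 2" using assms(2,3) by simp
  also have "\<dots> = q * (a ^ 2 - c ^ 2)" by (simp add: algebra_simps)
  finally have "q dvd (a * d - b * c) * (a * d - (- b) * c)" by simp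
  hence "q dvd a * d - b * c \<or> q dvd a * d - (- b) * c" using assms(1) by (simp only: prime_dvd_mult_iff)
  thus ?thesis
    using two_squares_unique_aux[OF q0 assms(2,3)] two_squares_unique_aux[OF q0 _ assms(3), of a "- b"] assms(2)
    by auto
qed

lemma p_integral_quotient:
  assumes "prime p" "\<not> int p dvd b"
  shows "of_int a / of_int b \<in> p_integral p"
proof -
  let ?r = "of_int a / of_int b :: rat"
  obtain u v where uv: "quotient_of ?r = (u, v)" by (cases "quotient_of ?r")
  have b0: "b \<noteq> 0" using assms(2) by auto
  have v0: "v > 0" and co: "coprime u v" and r: "?r = of_int u / of_int v"
    using uv quotient_of_denom_pos quotient_of_coprime quotient_of_div by blast+
  have "of_int a * of_int v = (of_int u * of_int b :: rat)" using r b0 v0 by (simp add: field_simps)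
  hence e: "a * v = u * b" by (metis of_int_eq_iff of_int_mult)
  have "\<not> int p dvd v"
  proof
    assume v: "int p dvd v"
    hence "int p dvd u * b" using e by (metis dvd_mult)
    hence "int p dvd u" using assms by (simp add: prime_dvd_mult_iff)
    hence "int p dvd 1" using v co by (meson coprime_common_divisor dvd_refl one_dvd)
    thus False using assms(1) by (simp add: prime_gt_1_nat)
  qed
  thus ?thesis by (simp add: p_integral_def uv)
qed

text \<open>A congruence in the local ring may be checked after multiplication
    by a common denominator prime to \<open>p\<close>.\<close>
lemma rat_cong_cleared:
  assumes "prime p" "\<not> int p dvd d" "of_int d * s = (of_int m :: rat)" "[m = d * r] (mod int p)"
  shows "rat_cong s (of_int r) p"
proof -
  have d0: "d \<noteq> 0" using assms(2) by auto
  obtain q where q: "m - d * r = int p * q" using assms(4) by (auto simp: cong_iff_dvd_diff elim: dvdE)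
  have s: "s = of_int m / of_int d" using assms(3) d0 by (simp add: field_simps)
  have "s - of_int r = of_int (m - d * r) / of_int d" using d0 by (simp add: s field_simps)
  also have "\<dots> = of_nat p * (of_int q / of_int d)" unfolding q by simp
  finally have "s - of_int r = of_nat p * (of_int q / of_int d)" .
  moreover have "of_int r \<in> p_integral p"
    using p_integral_quotient[of p 1 r] assms(1) prime_gt_1_nat[OF assms(1)] by simp
  ultimately show ?thesis
    unfolding rat_cong_def using p_integral_quotient[OF assms(1,2)] s by blast
qed

section \<open>The congruence\<close>

lemma three_is_square_mod:
  assumes "prime p" "p mod 12 = 1"
  shows "\<exists>s. [s ^ 2 = 3] (mod int p)"
proof -
  have p2: "2 < p" using assms prime_gt_1_nat[of p] by (cases "p = 2") auto
  have p3: "3 \<noteq> p" using assms(2) by auto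
  have "Legendre (int 3) (int p) * Legendre (int p) (int 3) = (-1) ^ ((3 - 1) div 2 * ((p - 1) div 2))"
    using Quadratic_Reciprocity[of 3 p] assms(1) p2 p3 by simp
  moreover have "even ((3 - 1) div 2 * ((p - 1) div 2))"
  proof -
    have "even ((p - 1) div 2)" using assms(2) by presburger
    thus ?thesis by simp
  qed
  ultimately have "Legendre 3 (int p) * Legendre (int p) 3 = 1" by simp
  moreover have "Legendre (int p) 3 = 1"
  proof -
    have "int p mod 3 = 1" using assms(2) by presburger
    hence 1: "[1 ^ 2 = int p] (mod 3)" by (simp add: cong_def)
    hence "QuadRes 3 (int p)" unfolding QuadRes_def by blast
    moreover have "\<not> [int p = 0] (mod 3)" using \<open>int p mod 3 = 1\<close> by (simp add: cong_def)
    ultimately show ?thesis by (simp add: Legendre_def)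
  qed
  ultimately have "Legendre 3 (int p) = 1" by simp
  hence "QuadRes (int p) 3" by (auto simp: Legendre_def split: if_splits)
  thus ?thesis unfolding QuadRes_def .
qed

text \<open>
  This combines the three parts: \<open>w = 2 + 2 \<surd>3\<close> is a root of \<open>w\<^sup>2 = 4w + 8\<close>, and its inverse \<open>z\<close> is a
  root of \<open>8z\<^sup>2 + 4z - 1\<close>.
\<close>
lemma franel_sum_and_representation:
  assumes "prime p" "p mod 12 = 1"
  shows "\<exists>A B. int p = A ^ 2 + 9 * B ^ 2 \<and> \<not> 3 dvd A \<and>
     [(\<Sum>k<p. int (central_franel k) * (-16) ^ (p - 1 - k)) = 4 * A ^ 2] (mod int p)"
proof -
  have p3: "p > 3" using assms prime_gt_1_nat[of p] by (cases "p = 2 \<or> p = 3") auto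
  interpret prime_1_mod_4 p
    using assms p3 by unfold_locales presburger+
  define n where "n = (p - 1) div 2"
  have n: "p = 2 * n + 1" using assms(2) unfolding n_def by presburger
  obtain s where s: "[s ^ 2 = 3] (mod int p)" using three_is_square_mod[OF assms] by blast
  define w where "w = 2 + 2 * s"
  have wd: "int p dvd w ^ 2 - (4 * w + 8)"
  proof -
    have e: "w ^ 2 - (4 * w + 8) = 4 * (s ^ 2 - 3)" by (simp add: w_def power2_eq_square algebra_simps)
    show ?thesis unfolding e using s unfolding cong_iff_dvd_diff by (rule dvd_mult)
  qed
  hence ww: "[w ^ 2 = 4 * w + 8] (mod int p)" by (simp add: cong_iff_dvd_diff)
  have n3: "\<not> int p dvd 3" using p3 by (auto dest: zdvd_imp_le)
  have n8: "\<not> int p dvd 8"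
    using p_dvd_power[of 2 3] p_not_dvd_2 by auto
  have w0: "\<not> int p dvd w"
  proof
    assume a: "int p dvd w"
    have "int p dvd w * (w - 4) - (w ^ 2 - (4 * w + 8))" by (rule dvd_diff[OF dvd_mult2[OF a] wd])
    also have "w * (w - 4) - (w ^ 2 - (4 * w + 8)) = 8" by (simp add: power2_eq_square algebra_simps)
    finally show False using n8 by simp
  qed
  have w1: "\<not> int p dvd w + 1"
  proof
    assume a: "int p dvd w + 1"
    have "int p dvd (w + 1) * (w - 5) - (w ^ 2 - (4 * w + 8))" by (rule dvd_diff[OF dvd_mult2[OF a] wd])
    also have "(w + 1) * (w - 5) - (w ^ 2 - (4 * w + 8)) = 3" by (simp add: power2_eq_square algebra_simps)
    finally show False using n3 by simp
  qed
  have w8: "\<not> int p dvd w - 8"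
  proof
    assume a: "int p dvd w - 8"
    have "int p dvd (w ^ 2 - (4 * w + 8)) - (w - 8) * (w + 4)" by (rule dvd_diff[OF wd dvd_mult2[OF a]])
    also have "(w ^ 2 - (4 * w + 8)) - (w - 8) * (w + 4) = 8 * 3" by (simp add: power2_eq_square algebra_simps)
    finally show False using n8 n3 p_dvd_mult by blast
  qed
  have b: "\<not> int p dvd w ^ 3 * (w - 8)" using w0 w8 p_dvd_mult p_dvd_power by blast
  have "coprime w (int p)" using w0 prime_int_p by (metis coprime_commute prime_imp_coprime)
  then obtain z where wz: "[w * z = 1] (mod int p)" using cong_solve_coprime_int by blast
  hence zw: "[z * w = 1] (mod int p)" by (simp add: mult.commute)
  have z: "[8 * z ^ 2 + 4 * z = 1] (mod int p)"
  proof -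
    have "8 * z ^ 2 + 4 * z - 1 = (w * z - 1) * (w * z + 1 - 4 * z) - (w ^ 2 - (4 * w + 8)) * z ^ 2"
      by (simp add: power2_eq_square algebra_simps)
    moreover have "int p dvd (w * z - 1) * (w * z + 1 - 4 * z) - (w ^ 2 - (4 * w + 8)) * z ^ 2"
      using wz by (intro dvd_diff[OF dvd_mult2 dvd_mult2[OF wd]]) (simp add: cong_iff_dvd_diff)
    ultimately show ?thesis by (simp only: cong_iff_dvd_diff)
  qed
  obtain A B where A: "cubic_sum (w ^ 3 * (w - 8)) = 2 * A" and AB: "int p = A ^ 2 + B ^ 2"
    using cubic_sum_two_squares[OF b] by blast
  have N: "torus_count w = int p
      - 5 + 2 * A" using torus_count_eq_sum[OF w0 w1] sum_eq_cubic_sum[OF w0 ww] A by simp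
  have p1: "int p mod 3 = 1" using assms(2) by presburger
  have A3: "\<not> 3 dvd A"
  proof
    assume "3 dvd A"
    moreover have "3 dvd int p - 5 + 2 * A" using three_dvd_torus_count[OF p3 ww] unfolding N .
    ultimately show False using p1 by presburger
  qed
  have B3: "3 dvd B"
  proof (rule ccontr)
    assume "\<not> 3 dvd B"
    have sq: "x ^ 2 mod 3 = 1" if "\<not> 3 dvd x" for x :: int
    proof -
      have "x mod 3 = 1 \<or> x mod 3 = 2" using that by presburger
      hence "(x mod 3) ^ 2 mod 3 = 1" by auto
      thus ?thesis by (simp add: power_mod)
    qed
    have "A ^ 2 mod 3 = 1" "B ^ 2 mod 3 = 1" using sq A3 \<open>\<not> 3 dvd B\<close> by auto
    hence "(A ^ 2 + B ^ 2) mod 3 = 2" by presburger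
    thus False using p1 AB by simp
  qed
  then obtain C where C: "B = 3 * C" by (elim dvdE)
  have "[poly (franel_poly p) z = - 2 * A] (mod int p)"
  proof -
    have "[- 5 - torus_count w = - 5 - (- 5 - poly (franel_poly p) z)] (mod int p)"
      by (intro cong_diff cong_refl torus_count_cong zw)
    moreover have "- 5 - torus_count w = - 2 * A - int p" unfolding N by simp
    moreover have "- 5 - (- 5 - poly (franel_poly p) z) = poly (franel_poly p) z" by simp
    ultimately have "[- 2 * A - int p = poly (franel_poly p) z] (mod int p)" by (simp only:)
    moreover have "[- 2 * A - int p = - 2 * A] (mod int p)" by (simp add: cong_iff_dvd_diff)
    ultimately show ?thesis using cong_sym cong_trans by blast
  qed
  hence "[(poly (franel_poly p) z) ^ 2 = (- 2 * A) ^ 2] (mod int p)" by (rule cong_pow)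
  hence "[(\<Sum>k<p. int (central_franel k) * (-16) ^ (p - 1 - k)) = (- 2 * A) ^ 2] (mod int p)"
    by (rule cong_trans[OF franel_sum_square[OF assms(1) n p3 z]])
  also have "(- 2 * A) ^ 2 = 4 * A ^ 2" by (simp add: power_mult_distrib)
  finally have "[(\<Sum>k<p. int (central_franel k) * (-16) ^ (p - 1 - k)) = 4 * A ^ 2] (mod int p)" .
  moreover have "int p = A ^ 2 + 9 * C ^ 2" using AB C by (simp add: power_mult_distrib)
  ultimately show ?thesis using A3 by blast
qed

theorem theorem2p8:
  fixes p :: nat
  assumes "prime p" and "\<exists>m. p = 12 * m + 1"
  shows "(\<exists>x y :: int. int p = x\<^sup>2 + 9 * y\<^sup>2) \<and>
    (\<forall>x y :: int. int p = x\<^sup>2 + 9 * y\<^sup>2 \<longrightarrow>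
      rat_cong (\<Sum>k=0..p-1. of_nat ((2 * k) choose k) * of_nat (franel k) / (-16) ^ k)
        (of_int (4 * x\<^sup>2)) p)"
proof -
  have m12: "p mod 12 = 1" using assms(2) by auto
  have p0: "Suc (p - 1) = p" using assms(1) prime_gt_0_nat by simp
  obtain A B where AB: "int p = A ^ 2 + 9 * B ^ 2" and A3: "\<not> 3 dvd A"
    and sum: "[(\<Sum>k<p. int (central_franel k) * (-16) ^ (p - 1 - k)) = 4 * A ^ 2] (mod int p)"
    using franel_sum_and_representation[OF assms(1) m12] by blast
  have x_unique: "x ^ 2 = A ^ 2" if "int p = x ^ 2 + 9 * y ^ 2" for x y :: int
  proof -
    have "int p = A ^ 2 + (3 * B) ^ 2" "int p = x ^ 2 + (3 * y) ^ 2"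
      using AB that by (simp_all add: power_mult_distrib)
    moreover have "prime (int p)" using assms(1) by simp
    ultimately have "A ^ 2 = x ^ 2 \<or> A ^ 2 = (3 * y) ^ 2" using two_squares_unique by blast
    moreover have "A ^ 2 \<noteq> (3 * y) ^ 2"
    proof
      assume "A ^ 2 = (3 * y) ^ 2"
      hence "A = 3 * y \<or> A = - (3 * y)" by (simp only: power2_eq_iff)
      thus False using A3 by auto
    qed
    ultimately show ?thesis by simp
  qed
  have n16: "\<not> int p dvd (-16) ^ (p - 1)"
  proof
    have pi: "prime (int p)" using assms(1) by simp
    assume "int p dvd (-16) ^ (p - 1)"
    hence "int p dvd -16" by (rule prime_dvd_power[OF pi])
    hence "int p dvd 2 ^ 4" by simp
    hence "int p dvd 2" by (rule prime_dvd_power[OF pi])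
    hence "int p \<le> 2" by (rule zdvd_imp_le) simp
    thus False using m12 prime_gt_1_nat[OF assms(1)] by (cases "p = 2") auto
  qed
  have "rat_cong (\<Sum>k=0..p-1. of_nat ((2 * k) choose k) * of_nat (franel k) / (-16) ^ k) (of_int (4
      * x ^ 2)) p"
    if "int p = x ^ 2 + 9 * y ^ 2" for x y :: int
  proof (rule rat_cong_cleared[OF assms(1) n16])
    have "of_int ((-16) ^ (p - 1)) * (\<Sum>k=0..p-1. of_nat ((2 * k) choose k) * of_nat (franel k) / (-16) ^ k)
        = (\<Sum>k=0..p-1. of_int (int (central_franel k) * (-16) ^ (p - 1 - k)) :: rat)"
      unfolding sum_distrib_left
    proof (rule sum.cong[OF refl])
      fix k assume "k \<in> {0..p-1}"
      hence "(p - 1 - k) + k = p - 1" by simp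
      hence "((-16) :: rat) ^ (p - 1) = (-16) ^ (p - 1 - k) * (-16) ^ k"
        unfolding power_add[symmetric] by (simp only:)
      thus "of_int ((-16) ^ (p - 1)) * (of_nat ((2 * k) choose k) * of_nat (franel k) / (-16) ^ k)
          = (of_int (int (central_franel k) * (-16) ^ (p - 1 - k)) :: rat)"
        by (simp add: central_franel_def)
    qed
    also have "\<dots> = of_int (\<Sum>k<p. int (central_franel k) * (-16) ^ (p - 1 - k))"
    proof -
      have "{0..p-1} = {..<p}" using p0 by auto
      thus ?thesis by simp
    qed
    finally show "of_int ((-16) ^ (p - 1)) * (\<Sum>k=0..p-1. of_nat ((2 * k) choose k)
        * of_nat (franel k) / (-16) ^ k)
        = (of_int (\<Sum>k<p. int (central_franel k) * (-16) ^ (p - 1 - k)) :: rat)" .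
    have "[1 * (4 * x ^ 2) = (-16) ^ (p - 1) * (4 * x ^ 2)] (mod int p)"
    proof (rule cong_scalar_right[OF cong_sym[OF fermat_int[OF assms(1)]]])
      show "\<not> int p dvd -16" 
      proof
        assume "int p dvd -16"
        hence "int p dvd (-16) * (-16) ^ (p - 2)" by (rule dvd_mult2)
        hence "int p dvd (-16) ^ Suc (p - 2)" by (simp only: power_Suc)
        moreover have "Suc (p - 2) = p - 1" using prime_gt_1_nat[OF assms(1)] by simp
        ultimately show False using n16 by (simp only: simp_thms)
      qed
    qed
    thus "[(\<Sum>k<p. int (central_franel k) * (-16) ^ (p - 1 - k))
        = (-16) ^ (p - 1) * (4 * x ^ 2)] (mod int p)"
      unfolding x_unique[OF that] mult_1 by (rule cong_trans[OF sum])
  qed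
  thus ?thesis using AB by blast
qed

end
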